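(* Let $G$ be a connected graph, let $V_0, V_1, V'_1$ be three pairwise disjoint subsets of $V(G)$, let $f:V_0\rightarrow \mathbb{Z}_2$ be a mapping, and let $\varepsilon$ be a real number with $0< \varepsilon < 1$. Assume that $\sum_{v\in V_0}f(v)\equiv 0 \pmod 2$ or $V_0\neq V(G)$. Call a subset $X\subseteq V_0$ exceptional if either $G[X]$ is disconnected, or $G[X]$ is bipartite and for all $v\in X$, $\varepsilon d_G(v)$ is an integer with the same parity as $f(v)$. Assume that every nonempty proper subset $X$ of $V_0$ that is not exceptional satisfies: $d_G(X)\ge 1/\varepsilon$ whenever $\sum_{v\in X}f(v)$ is odd, and $d_G(X)\ge 1/(1-\varepsilon)$ whenever $\sum_{v\in X}(d_G(v)-f(v))$ is odd. Then $G$ has a factor $F$ with the following properties: (1) for all $v\in V_0$, $\lfloor \varepsilon d_G(v)\rfloor -1 \le d_{F}(v) \le \lceil \varepsilon d_G(v)\rceil +1$ and $d_F(v)\equiv f(v)\pmod 2$; (2) for all $v\in V_1$, $\lceil \varepsilon d_G(v)\rceil -1\le d_{F}(v) \le \lceil \varepsilon d_G(v)\rceil$; (3) for all $v\in V'_1$, $\lfloor \varepsilon d_G(v)\rfloor \le d_{F}(v) \le \lfloor \varepsilon d_G(v)\rfloor +1$. Furthermore, for an arbitrary given vertex $z\in V_0$, one can choose $F$ to satisfy in addition whichever one of the following two inequalities is desired: $d_{F}(z) \ge \lceil \varepsilon d_G(z)\rceil-1$, or $d_{F}(z) \le \lfloor \varepsilon d_G(z)\rfloor +1$.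
   Context: Graphs may have loops and multiple edges; $d_G(v)$ is the degree of $v$ in $G$ (a loop counts twice). A factor of $G$ is a spanning subgraph of $G$. For a vertex set $X$, $d_G(X)$ is the number of edges of $G$ with exactly one end in $X$, and $G[X]$ is the subgraph induced by $X$. Values of $f$ in $\mathbb{Z}_2$ are identified with $0$ and $1$ when discussing parity. *)

theory Defs
  imports Complex_Main "HOL-Library.Uprod" "HOL-Library.Z2"
begin

text \<open>
  Finite undirected graphs, with loops and multiple edges allowed: edges are named objects and
  \<open>ends e\<close> is the unordered pair of ends of \<open>e\<close>; a loop at \<open>v\<close> has \<open>ends e = Upair v v\<close>.
  The values of \<open>ends\<close> outside \<open>edges\<close> are irrelevant.
\<close>

record ('v, 'e) mgraph =
  verts :: "'v set"
  edges :: "'e set"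
  ends :: "'e \<Rightarrow> 'v uprod"

locale finite_mgraph =
  fixes G :: "('v, 'e) mgraph"
  assumes finite_verts: "finite (verts G)"
    and finite_edges: "finite (edges G)"
    and ends_in_verts: "e \<in> edges G \<Longrightarrow> set_uprod (ends G e) \<subseteq> verts G"

text \<open>The second summand counts the loops at \<open>v\<close> once more.\<close>

definition degree :: "('v, 'e) mgraph \<Rightarrow> 'v \<Rightarrow> nat" where
  "degree G v = card {e \<in> edges G. v \<in> set_uprod (ends G e)}
              + card {e \<in> edges G. ends G e = Upair v v}"

definition cut_degree :: "('v, 'e) mgraph \<Rightarrow> 'v set \<Rightarrow> nat" where
  "cut_degree G X = card {e \<in> edges G. \<exists>u v. ends G e = Upair u v \<and> u \<in> X \<and> v \<notin> X}"

definition induced_subgraph :: "('v, 'e) mgraph \<Rightarrow> 'v set \<Rightarrow> ('v, 'e) mgraph" where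
  "induced_subgraph G X =
     \<lparr> verts = verts G \<inter> X,
       edges = {e \<in> edges G. set_uprod (ends G e) \<subseteq> X},
       ends = ends G \<rparr>"

definition adjacency :: "('v, 'e) mgraph \<Rightarrow> ('v \<times> 'v) set" where
  "adjacency G = {(u, v). \<exists>e \<in> edges G. ends G e = Upair u v}"

text \<open>By convention the graph without vertices is not connected.\<close>

definition graph_connected :: "('v, 'e) mgraph \<Rightarrow> bool" where
  "graph_connected G \<longleftrightarrow>
     verts G \<noteq> {} \<and> (\<forall>u \<in> verts G. \<forall>v \<in> verts G. (u, v) \<in> (adjacency G)\<^sup>*)"

definition bipartite :: "('v, 'e) mgraph \<Rightarrow> bool" where
  "bipartite G \<longleftrightarrow>
     (\<exists>A B. A \<union> B = verts G \<and> A \<inter> B = {} \<and>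
        (\<forall>e \<in> edges G. \<exists>a \<in> A. \<exists>b \<in> B. ends G e = Upair a b))"

definition is_factor :: "('v, 'e) mgraph \<Rightarrow> ('v, 'e) mgraph \<Rightarrow> bool" where
  "is_factor F G \<longleftrightarrow>
     verts F = verts G \<and> edges F \<subseteq> edges G \<and> (\<forall>e \<in> edges F. ends F e = ends G e)"

text \<open>
  Elements of $Z_2$ are values of type \<^typ>\<open>bit\<close>; an integer \<open>k\<close> has the parity of
  \<open>x :: bit\<close> iff \<open>of_int k = x\<close>, and a sum of values in \<^typ>\<open>bit\<close> is odd iff it equals 1.
\<close>

definition exceptional ::
    "('v, 'e) mgraph \<Rightarrow> ('v \<Rightarrow> bit) \<Rightarrow> real \<Rightarrow> 'v set \<Rightarrow> bool" where
  "exceptional G f \<epsilon> X \<longleftrightarrow>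
     \<not> graph_connected (induced_subgraph G X) \<or>
     (bipartite (induced_subgraph G X) \<and>
      (\<forall>v \<in> X. \<exists>k :: int. \<epsilon> * real (degree G v) = of_int k \<and> of_int k = f v))"

definition good_factor ::
    "('v, 'e) mgraph \<Rightarrow> 'v set \<Rightarrow> 'v set \<Rightarrow> 'v set \<Rightarrow> ('v \<Rightarrow> bit) \<Rightarrow> real \<Rightarrow>
     ('v, 'e) mgraph \<Rightarrow> bool" where
  "good_factor G V\<^sub>0 V\<^sub>1 V\<^sub>1' f \<epsilon> F \<longleftrightarrow>
     is_factor F G \<and>
     (\<forall>v \<in> V\<^sub>0. \<lfloor>\<epsilon> * real (degree G v)\<rfloor> - 1 \<le> int (degree F v) \<and>
               int (degree F v) \<le> \<lceil>\<epsilon> * real (degree G v)\<rceil> + 1 \<and>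
               of_nat (degree F v) = f v) \<and>
     (\<forall>v \<in> V\<^sub>1. \<lceil>\<epsilon> * real (degree G v)\<rceil> - 1 \<le> int (degree F v) \<and>
               int (degree F v) \<le> \<lceil>\<epsilon> * real (degree G v)\<rceil>) \<and>
     (\<forall>v \<in> V\<^sub>1'. \<lfloor>\<epsilon> * real (degree G v)\<rfloor> \<le> int (degree F v) \<and>
                int (degree F v) \<le> \<lfloor>\<epsilon> * real (degree G v)\<rfloor> + 1)"

end

theory Submission
  imports Defs
begin

text \<open>
  Giving every edge the weight \<open>\<epsilon>\<close> is a fractional factor whose degrees are exactly
  \<open>\<epsilon> d(v)\<close>. The theorem says that it can be rounded to a factor with prescribed parities on
  \<open>V\<^sub>0\<close>, and the proof has two halves.

  The first half is Lovasz's \<open>(l, h)\<close>-factor theorem for multigraphs with loops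
  (\<open>factor_theorem\<close>). If no edge set has all its degrees between \<open>l\<close> and \<open>h\<close>, then there are disjoint vertex
  sets \<open>S\<close>, \<open>T\<close> and too many "odd blocks": components \<open>K\<close> outside \<open>S \<union> T\<close> on which \<open>l = h\<close> and the
  parity of the demand is wrong. The only combinatorial input is an exchange property of degree
  vectors (\<open>alternating_trail\<close>): given two edge sets and a vertex where their degrees differ, an
  alternating trail moves both degree vectors two unit steps towards each other. Measure a degree
  vector by its total distance from the intervals \<open>[l v, h v]\<close>. A vertex can be moved to \<open>S\<close> (or \<open>T\<close>),
  which replaces its distance by the linear function \<open>x - h\<close> (or \<open>l - x\<close>), as long as this does not
  lower the minimum. Once no further vertex can be moved, the optimal vectors are very rigid: a vertex outside
  \<open>S \<union> T\<close> that ever deviates does so by exactly 1, in both directions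
  (\<open>over_step\<close>), and every component contains at most one deviating vertex at a time
  (\<open>single_deviation\<close>, the analogue of Gallai's lemma). Counting the edges at \<open>S\<close> and \<open>T\<close> then gives the
  formula of the theorem. Since a deviation can be turned over inside its component, the
  components that deviate are not bipartite (\<open>block_not_bipartite\<close>); this is where the exceptional
  bipartite sets of the theorem come from.

  The second half (\<open>parity_rounding\<close>) applies this to the graph in which each \<open>v \<in> V\<^sub>0\<close> whose
  admissible degrees are \<open>k - 2\<close> and \<open>k\<close> gets an extra loop and the exact target \<open>k\<close>. With a
  suitable weight on this loop the fractional factor meets the targets, and an obstruction
  \<open>(S, T)\<close> must have an odd block \<open>K\<close> with \<open>\<epsilon> d(K, S) + (1 - \<epsilon>) d(K, T) < 1\<close>. This is
  impossible if \<open>K\<close> has edges to both \<open>S\<close> and \<open>T\<close>. Otherwise \<open>K\<close> satisfies one of the two parity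
  conditions under which the hypothesis bounds \<open>d(K)\<close> from below. The hypothesis applies because \<open>K\<close> is not
  exceptional: it is connected and, together with the extra loops, not bipartite, while a vertex gets
  no loop if \<open>\<epsilon> d(v)\<close> is an integer of parity \<open>f(v)\<close>. All estimates leave room for an error of less than 1, because the deficiency is an
  integer. This room is spent on the distinguished vertex \<open>z\<close>, whose target may miss \<open>\<epsilon> d(z)\<close> by
  less than 1, or on the block \<open>K = V\<^sub>0\<close>, which is not covered by the hypothesis; both do not occur
  together, as \<open>z\<close> lies in \<open>V\<^sub>0\<close>.
\<close>

section \<open>Alternating trails and the exchange property\<close>

definition shift :: "('v \<Rightarrow> int) \<Rightarrow> 'v \<Rightarrow> int \<Rightarrow> 'v \<Rightarrow> int" where
  "shift x u s = x(u := x u + s)"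

text \<open>
  A strong form of the axiom of constant-parity jump systems: the two steps from \<open>x\<close> towards \<open>y\<close>
  can simultaneously be undone at \<open>y\<close>. The double step \<open>w = u\<close> needs a gap of at least 2 in order not
  to overshoot.
\<close>

definition exchangeable :: "('v \<Rightarrow> int) set \<Rightarrow> bool" where
  "exchangeable J \<longleftrightarrow>
     (\<forall>x\<in>J. \<forall>y\<in>J. \<forall>u s. \<bar>s\<bar> = 1 \<longrightarrow> 0 < s * (y u - x u) \<longrightarrow>
        (\<exists>w t. \<bar>t\<bar> = 1 \<and> shift (shift x u s) w t \<in> J \<and> shift (shift y u (-s)) w (-t) \<in> J \<and>
           (if w = u then t = s \<and> 2 \<le> s * (y u - x u) else 0 < t * (y w - x w))))"

text \<open>
  Edges are given by two end maps \<open>a\<close> and \<open>b\<close>, in an arbitrary order of the ends, so that a loop is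
  counted twice without a case distinction.
\<close>

definition edeg :: "('e \<Rightarrow> 'v) \<Rightarrow> ('e \<Rightarrow> 'v) \<Rightarrow> 'e set \<Rightarrow> 'v \<Rightarrow> int" where
  "edeg a b F v = (\<Sum>e\<in>F. of_bool (a e = v) + of_bool (b e = v))"

definition degree_vectors :: "('e \<Rightarrow> 'v) \<Rightarrow> ('e \<Rightarrow> 'v) \<Rightarrow> 'e set \<Rightarrow> ('v \<Rightarrow> int) set" where
  "degree_vectors a b E = edeg a b ` Pow E"

lemma edeg_insert:
  "finite F \<Longrightarrow> e \<notin> F \<Longrightarrow> edeg a b (insert e F) = shift (shift (edeg a b F) (a e) 1) (b e) 1"
  by (auto simp: edeg_def shift_def fun_eq_iff)

lemma edeg_remove:
  assumes "finite F" "e \<in> F"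
  shows "edeg a b (F - {e}) = shift (shift (edeg a b F) (a e) (-1)) (b e) (-1)"
proof -
  have "edeg a b F = shift (shift (edeg a b (F - {e})) (a e) 1) (b e) 1"
    using edeg_insert[of "F - {e}" e a b] assms by (simp add: insert_absorb)
  then show ?thesis by (auto simp: shift_def fun_eq_iff)
qed

lemma shift_commute: "shift (shift x u s) w t = shift (shift x w t) u s"
  by (auto simp: shift_def fun_eq_iff)

lemma shift_shift: "shift (shift x u s) u t = shift x u (s + t)"
  by (auto simp: shift_def fun_eq_iff)

lemma shift_zero [simp]: "shift x u 0 = x"
  by (auto simp: shift_def fun_eq_iff)

text \<open>
  The trail is grown from \<open>u\<close>. After its first edge \<open>uv\<close> is flipped either \<open>v\<close> has moved in the right
  direction, and the trail stops, or \<open>v\<close> has moved away from \<open>F'\<close>. In that case it has to be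
  corrected by a step of the opposite sign, and this trail exists by induction, since \<open>F\<close> has come
  closer to \<open>F'\<close>.
\<close>

lemma alternating_trail:
  assumes "finite F" "finite F'" "\<bar>s\<bar> = 1" "0 < s * (edeg a b F' u - edeg a b F u)"
  shows "\<exists>P w t. P \<subseteq> sym_diff F F' \<and> \<bar>t\<bar> = 1 \<and>
           edeg a b (sym_diff F P) = shift (shift (edeg a b F) u s) w t \<and>
           (if w = u then t = s \<and> 2 \<le> s * (edeg a b F' u - edeg a b F u)
            else 0 < t * (edeg a b F' w - edeg a b F w))"
  using assms
proof (induction "card (sym_diff F F')" arbitrary: F u s rule: less_induct)
  case less
  let ?d = "edeg a b"
  note fin = less.prems(1,2)
  \<comment> \<open>the first edge of the trail: it starts at \<open>u\<close> and moves its degree in direction \<open>s\<close>\<close>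
  have "\<exists>e v. e \<in> sym_diff F F' \<and> ((a e = u \<and> b e = v) \<or> (a e = v \<and> b e = u)) \<and>
           ?d (sym_diff F {e}) = shift (shift (?d F) u s) v s"
  proof (cases "s = 1")
    case True
    have "\<exists>e\<in>F' - F. a e = u \<or> b e = u"
    proof (rule ccontr)
      assume "\<not> ?thesis"
      then have "?d F' u = ?d (F' \<inter> F) u"
        unfolding edeg_def using fin by (intro sum.mono_neutral_right) auto
      also have "\<dots> \<le> ?d F u" unfolding edeg_def using fin by (intro sum_mono2) auto
      finally show False using less.prems True by simp
    qed
    then obtain e where e: "e \<in> F' - F" "a e = u \<or> b e = u" by blast
    then have "sym_diff F {e} = insert e F" by auto
    then show ?thesis using e edeg_insert[of F e a b] fin True
      by (metis Diff_iff UnI2 shift_commute)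
  next
    case False
    then have s: "s = -1" using less.prems by auto
    have "\<exists>e\<in>F - F'. a e = u \<or> b e = u"
    proof (rule ccontr)
      assume "\<not> ?thesis"
      then have "?d F u = ?d (F' \<inter> F) u"
        unfolding edeg_def using fin by (intro sum.mono_neutral_right) auto
      also have "\<dots> \<le> ?d F' u" unfolding edeg_def using fin by (intro sum_mono2) auto
      finally show False using less.prems s by simp
    qed
    then obtain e where e: "e \<in> F - F'" "a e = u \<or> b e = u" by blast
    then have "sym_diff F {e} = F - {e}" by auto
    then show ?thesis using e edeg_remove[of F e a b] fin s
      by (metis Diff_iff UnI1 shift_commute)
  qed
  then obtain e v where e: "e \<in> sym_diff F F'"
    and d1: "?d (sym_diff F {e}) = shift (shift (?d F) u s) v s" by blast
  let ?F1 = "sym_diff F {e}"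
  have sd: "sym_diff ?F1 F' = sym_diff F F' - {e}" using e by auto
  have card: "card (sym_diff ?F1 F') < card (sym_diff F F')"
    unfolding sd using e fin by (intro card_Diff1_less) auto
  have fin1: "finite ?F1" using fin by auto
  show ?case
  proof (cases "if v = u then 2 \<le> s * (?d F' u - ?d F u) else 0 < s * (?d F' v - ?d F v)")
    case True
    then show ?thesis using e d1 less.prems
      by (intro exI[of _ "{e}"] exI[of _ v] exI[of _ s]) (auto split: if_splits)
  next
    case False
    have s: "s = 1 \<or> s = -1" using less.prems by auto
    \<comment> \<open>\<open>v\<close> is now on the wrong side of \<open>F'\<close>; for a loop, \<open>v = u\<close> has overshot its target by 1\<close>
    have gap: "0 < (-s) * (?d F' v - ?d ?F1 v)"
      using False s less.prems(4) unfolding d1 by (auto simp: shift_def split: if_splits)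
    obtain P w t where P: "P \<subseteq> sym_diff ?F1 F'" and t: "\<bar>t\<bar> = 1"
      and d2: "?d (sym_diff ?F1 P) = shift (shift (?d ?F1) v (-s)) w t"
      and cond: "if w = v then t = - s \<and> 2 \<le> (-s) * (?d F' v - ?d ?F1 v)
            else 0 < t * (?d F' w - ?d ?F1 w)"
      using less.hyps[OF card fin1 fin(2) _ gap] less.prems(3) by auto
    have tt: "t = 1 \<or> t = -1" using t by auto
    have "e \<notin> P" using P sd by auto
    then have eq: "sym_diff ?F1 P = sym_diff F (insert e P)" by auto
    have sub: "insert e P \<subseteq> sym_diff F F'" using P sd e by auto
    have d3: "?d (sym_diff F (insert e P)) = shift (shift (?d F) u s) w t"
      using d2 unfolding eq d1 by (simp add: shift_shift)
    have "if w = u then t = s \<and> 2 \<le> s * (?d F' u - ?d F u) else 0 < t * (?d F' w - ?d F w)"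
      using cond s less.prems(4) gap tt unfolding d1
      by (elim disjE) (auto simp: shift_def split: if_splits)
    then show ?thesis using sub d3 t by blast
  qed
qed

lemma edeg_flip_sum:
  assumes "finite F" "finite F'" "P \<subseteq> sym_diff F F'"
  shows "edeg a b (sym_diff F P) v + edeg a b (sym_diff F' P) v = edeg a b F v + edeg a b F' v"
proof -
  let ?U = "F \<union> F'" and ?i = "\<lambda>e. of_bool (a e = v) + of_bool (b e = v) :: int"
  have ind: "edeg a b H v = (\<Sum>e\<in>?U. of_bool (e \<in> H) * ?i e)" if "H \<subseteq> ?U" for H
    unfolding edeg_def using assms that
    by (intro sum.mono_neutral_cong_left) auto
  have "edeg a b (sym_diff F P) v + edeg a b (sym_diff F' P) v
      = (\<Sum>e\<in>?U. (of_bool (e \<in> sym_diff F P) + of_bool (e \<in> sym_diff F' P)) * ?i e)"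
    using assms by (subst (1 2) ind) (auto simp: sum.distrib distrib_right)
  also have "\<dots> = (\<Sum>e\<in>?U. (of_bool (e \<in> F) + of_bool (e \<in> F')) * ?i e)"
    using assms(3) by (intro sum.cong refl) auto
  also have "\<dots> = edeg a b F v + edeg a b F' v"
    by (subst (1 2) ind) (auto simp: sum.distrib distrib_right)
  finally show ?thesis .
qed

text \<open>
  Flipping the same trail in \<open>F'\<close> moves its degrees by the opposite amount, because
  every edge of the trail belongs to exactly one of \<open>F\<close> and \<open>F'\<close>.
\<close>

lemma exchangeable_degree_vectors:
  assumes "finite E"
  shows "exchangeable (degree_vectors a b E)"
  unfolding exchangeable_def
proof (intro ballI allI impI)
  fix x y u and s :: int
  assume x: "x \<in> degree_vectors a b E" and y: "y \<in> degree_vectors a b E"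
    and s: "\<bar>s\<bar> = 1" and gap: "0 < s * (y u - x u)"
  from x y obtain F F' where F: "F \<subseteq> E" "x = edeg a b F" and F': "F' \<subseteq> E" "y = edeg a b F'"
    by (auto simp: degree_vectors_def)
  have fin: "finite F" "finite F'" using assms F F' finite_subset by auto
  obtain P w t where P: "P \<subseteq> sym_diff F F'" and t: "\<bar>t\<bar> = 1"
    and d: "edeg a b (sym_diff F P) = shift (shift x u s) w t"
    and c: "if w = u then t = s \<and> 2 \<le> s * (y u - x u) else 0 < t * (y w - x w)"
    using alternating_trail[OF fin s, of a b u] gap F F' by auto
  have "edeg a b (sym_diff F' P) = shift (shift y u (-s)) w (-t)"
  proof
    fix v
    show "edeg a b (sym_diff F' P) v = shift (shift y u (-s)) w (-t) v"
      using edeg_flip_sum[OF fin P, of a b v] unfolding d F(2)[symmetric] F'(2)[symmetric]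
      by (auto simp: shift_def split: if_splits)
  qed
  moreover have "sym_diff F P \<subseteq> E" "sym_diff F' P \<subseteq> E" using P F F' by auto
  ultimately show "\<exists>w t. \<bar>t\<bar> = 1 \<and> shift (shift x u s) w t \<in> degree_vectors a b E \<and>
      shift (shift y u (-s)) w (-t) \<in> degree_vectors a b E \<and>
      (if w = u then t = s \<and> 2 \<le> s * (y u - x u) else 0 < t * (y w - x w))"
    using t d c unfolding degree_vectors_def by (metis PowI imageI)
qed

section \<open>Penalties and saturated problems\<close>

text \<open>
  The marks \<open>1\<close> and \<open>-1\<close> stand for membership in the sets \<open>S\<close> and \<open>T\<close> of a barrier. There the distance
  of \<open>i\<close> from \<open>[l, h]\<close> is replaced by a linear lower bound of it.
\<close>

definition penalty :: "int \<Rightarrow> int \<Rightarrow> int \<Rightarrow> int \<Rightarrow> int" where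
  "penalty c l h i = (if c = 1 then i - h else if c = -1 then l - i else max 0 (max (i - h) (l - i)))"

definition total_penalty ::
    "'v set \<Rightarrow> ('v \<Rightarrow> int) \<Rightarrow> ('v \<Rightarrow> int) \<Rightarrow> ('v \<Rightarrow> int) \<Rightarrow> ('v \<Rightarrow> int) \<Rightarrow> int" where
  "total_penalty V l h c x = (\<Sum>v\<in>V. penalty (c v) (l v) (h v) (x v))"

lemma penalty_step_le: "\<bar>s\<bar> = 1 \<Longrightarrow> l \<le> h \<Longrightarrow> penalty c l h (i + s) \<le> penalty c l h i + 1"
  by (auto simp: penalty_def)

text \<open>
  All exchange arguments below rest on convexity in this form: if a step towards \<open>j\<close> harms at \<open>i\<close>,
  then undoing it helps at \<open>j\<close>, and if undoing it harms at \<open>j\<close>, then the step helps at \<open>i\<close>.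
\<close>

lemma penalty_convex:
  assumes "\<bar>t\<bar> = 1" "0 < t * (j - i)" "l \<le> h"
  shows "penalty c l h (i + t) - penalty c l h i \<le> penalty c l h j - penalty c l h (j - t)"
proof -
  from assms(1) have "t = 1 \<or> t = -1" by auto
  then show ?thesis using assms(2,3) by (elim disjE) (auto simp: penalty_def)
qed

lemma penalty_reflect: "penalty (- c) (- h) (- l) (- i) = penalty c l h i"
  by (auto simp: penalty_def)

lemma total_penalty_reflect:
  "total_penalty V (\<lambda>v. - h v) (\<lambda>v. - l v) (\<lambda>v. - c v) (\<lambda>v. - x v) = total_penalty V l h c x"
  by (simp add: total_penalty_def penalty_reflect)

lemma total_penalty_shift:
  assumes "finite V" "u \<in> V"
  shows "total_penalty V l h c (shift x u s) =
    total_penalty V l h c x - penalty (c u) (l u) (h u) (x u) + penalty (c u) (l u) (h u) (x u + s)"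
  unfolding total_penalty_def using assms
  by (simp add: sum.remove[of V u] shift_def)

lemma total_penalty_update:
  assumes "finite V" "u \<in> V"
  shows "total_penalty V l h (c(u := k)) x =
    total_penalty V l h c x - penalty (c u) (l u) (h u) (x u) + penalty k (l u) (h u) (x u)"
  unfolding total_penalty_def using assms by (simp add: sum.remove[of V u])

lemma exchangeable_reflect:
  assumes "exchangeable J"
  shows "exchangeable ((\<lambda>x v. - x v) ` J)"
  unfolding exchangeable_def
proof (intro ballI allI impI; elim imageE; hypsubst)
  fix x y u and s :: int
  assume x: "x \<in> J" and y: "y \<in> J" and s: "\<bar>s\<bar> = 1" and gap: "0 < s * (- y u - - x u)"
  have s': "\<bar>- s\<bar> = 1" and gap': "0 < - s * (y u - x u)" using s gap by (auto simp: algebra_simps)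
  obtain w t where t: "\<bar>t\<bar> = 1" and J: "shift (shift x u (- s)) w t \<in> J"
      "shift (shift y u (- (- s))) w (- t) \<in> J"
    and c: "if w = u then t = - s \<and> 2 \<le> - s * (y u - x u) else 0 < t * (y w - x w)"
    using assms x y s' gap' unfolding exchangeable_def by blast
  have eq: "shift (shift (\<lambda>v. - z v) u p) w q = (\<lambda>v. - shift (shift z u (-p)) w (-q) v)" for z p q
    by (auto simp: shift_def fun_eq_iff)
  show "\<exists>w t. \<bar>t\<bar> = 1 \<and> shift (shift (\<lambda>v. - x v) u s) w t \<in> (\<lambda>x v. - x v) ` J \<and>
      shift (shift (\<lambda>v. - y v) u (-s)) w (-t) \<in> (\<lambda>x v. - x v) ` J \<and>
      (if w = u then t = s \<and> 2 \<le> s * (- y u - - x u) else 0 < t * (- y w - - x w))"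
  proof (intro exI[of _ w] exI[of _ "- t"] conjI)
    show "shift (shift (\<lambda>v. - x v) u s) w (- t) \<in> (\<lambda>x v. - x v) ` J"
      unfolding eq using J(1) by simp
    show "shift (shift (\<lambda>v. - y v) u (-s)) w (- (- t)) \<in> (\<lambda>x v. - x v) ` J"
      unfolding eq using J(2) by simp
    show "if w = u then - t = s \<and> 2 \<le> s * (- y u - - x u) else 0 < - t * (- y w - - x w)"
      using c by (auto simp: algebra_simps split: if_splits)
  qed (use t in auto)
qed

text \<open>
  The marks \<open>c\<close> keep the minimum of the total penalty at \<open>m\<close>, but marking one more
  vertex in either way would lower it.
\<close>

locale saturated =
  fixes V :: "'v set" and J :: "('v \<Rightarrow> int) set" and l h c :: "'v \<Rightarrow> int" and m :: int
  assumes finite_V: "finite V"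
    and exchange: "exchangeable J"
    and support: "x \<in> J \<Longrightarrow> v \<notin> V \<Longrightarrow> x v = 0"
    and low_le_high: "l v \<le> h v"
    and minimum: "x \<in> J \<Longrightarrow> m \<le> total_penalty V l h c x"
    and saturated: "u \<in> V \<Longrightarrow> c u = 0 \<Longrightarrow> \<bar>k\<bar> = 1 \<Longrightarrow>
        \<exists>x\<in>J. total_penalty V l h (c(u := k)) x < m"
begin

abbreviation "pen \<equiv> total_penalty V l h c"
abbreviation "pen1 v i \<equiv> penalty (c v) (l v) (h v) i"

definition "optimal = {x \<in> J. pen x = m}"

text \<open>
  Negating all vectors exchanges the roles of "too large" and "too small", so that each
  statement about \<open>h\<close> has a mirror image about \<open>l\<close>.
\<close>

lemma reflect: "saturated V ((\<lambda>x v. - x v) ` J) (\<lambda>v. - h v) (\<lambda>v. - l v) (\<lambda>v. - c v) m"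
proof
  fix u and k :: int assume "u \<in> V" "- c u = 0" "\<bar>k\<bar> = 1"
  then obtain x where x: "x \<in> J" "total_penalty V l h (c(u := - k)) x < m"
    using saturated[of u "- k"] by auto
  have "(\<lambda>v. - c v)(u := k) = (\<lambda>v. - (c(u := - k)) v)" by auto
  then have "total_penalty V (\<lambda>v. - h v) (\<lambda>v. - l v) ((\<lambda>v. - c v)(u := k)) (\<lambda>v. - x v) < m"
    using x(2) by (simp only: total_penalty_reflect)
  then show "\<exists>x\<in>(\<lambda>x v. - x v) ` J. total_penalty V (\<lambda>v. - h v) (\<lambda>v. - l v) ((\<lambda>v. - c v)(u := k)) x < m"
    using x(1) by blast
qed (use finite_V support low_le_high minimum exchangeable_reflect[OF exchange]
      in \<open>auto simp: total_penalty_reflect\<close>)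

lemma exchangeD:
  assumes "x \<in> J" "y \<in> J" "\<bar>s\<bar> = 1" "0 < s * (y u - x u)"
  obtains w t where "\<bar>t\<bar> = 1" "shift (shift x u s) w t \<in> J" "shift (shift y u (-s)) w (-t) \<in> J"
    "w = u \<Longrightarrow> t = s" "w = u \<Longrightarrow> 2 \<le> s * (y u - x u)" "w \<noteq> u \<Longrightarrow> 0 < t * (y w - x w)"
  using exchange assms unfolding exchangeable_def by metis

lemma pen_shift:
  "u \<in> V \<Longrightarrow> pen (shift x u s) = pen x - pen1 u (x u) + pen1 u (x u + s)"
  using total_penalty_shift finite_V by metis

lemma pen_shift2:
  assumes "u \<in> V" "w \<in> V" "w \<noteq> u"
  shows "pen (shift (shift x u s) w t) =
    pen x - pen1 u (x u) + pen1 u (x u + s) - pen1 w (x w) + pen1 w (x w + t)"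
  using assms by (simp add: pen_shift) (simp add: shift_def)

lemma differ_in_V: "x \<in> J \<Longrightarrow> y \<in> J \<Longrightarrow> x w \<noteq> y w \<Longrightarrow> w \<in> V"
  using support by metis

text \<open>
  The reason is that \<open>u\<close> cannot be marked with \<open>1\<close>. This is witnessed by some \<open>x\<close> with
  \<open>x u < h u\<close>, and an exchange between \<open>x\<close> and \<open>y\<close> at \<open>u\<close> either is the double step to
  \<open>y u - 2\<close> or improves the witness. So an excess at \<open>u\<close> can be turned over into a shortage while
  nothing else changes.
\<close>

lemma over_step:
  assumes u: "u \<in> V" "c u = 0" and y: "y \<in> optimal" and over: "h u < y u"
  shows "y u = h u + 1 \<and> l u = h u \<and> shift y u (-2) \<in> optimal"
proof (rule ccontr)
  assume contra: "\<not> ?thesis"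
  let ?pen' = "total_penalty V l h (c(u := 1))"
  have yJ: "y \<in> J" and ym: "pen y = m" using y by (auto simp: optimal_def)
  have pen': "?pen' x = pen x - pen1 u (x u) + (x u - h u)" for x
    using total_penalty_update[OF finite_V u(1), of l h c 1 x] by (simp add: penalty_def)
  \<comment> \<open>there is no witness \<open>x\<close> against marking \<open>u\<close>: each one could be replaced by one with larger \<open>x u\<close>\<close>
  have False if "x \<in> J" "?pen' x < m" for x
    using that
  proof (induction "nat (h u - x u)" arbitrary: x rule: less_induct)
    case less
    have below: "x u < h u"
    proof (rule ccontr)
      assume "\<not> ?thesis"
      then have "?pen' x = pen x" using pen'[of x] u low_le_high[of u] by (auto simp: penalty_def)
      then show False using minimum less.prems by fastforce
    qed
    have gap_u: "0 < 1 * (y u - x u)" using over below by simp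
    obtain w t where t: "\<bar>t\<bar> = 1" and xJ: "shift (shift x u 1) w t \<in> J"
      and yJ': "shift (shift y u (-1)) w (-t) \<in> J"
      and c1: "w = u \<Longrightarrow> t = 1" and c2: "w \<noteq> u \<Longrightarrow> 0 < t * (y w - x w)"
      by (rule exchangeD[OF less.prems(1) yJ _ gap_u]) auto
    show False
    proof (cases "w = u")
      case True
      then have z: "shift y u (-2) \<in> J" using yJ' c1 by (simp add: shift_shift)
      have "m \<le> m - pen1 u (y u) + pen1 u (y u - 2)"
        using minimum[OF z] pen_shift[OF u(1), of y "-2"] ym by simp
      moreover from this have "y u = h u + 1 \<and> l u = h u"
        using over u(2) low_le_high[of u] by (auto simp: penalty_def split: if_splits)
      moreover from this have "pen (shift y u (-2)) = m"
        using pen_shift[OF u(1), of y "-2"] ym u(2) by (simp add: penalty_def)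
      ultimately show False using contra z by (auto simp: optimal_def)
    next
      case False
      then have gap: "0 < t * (y w - x w)" using c2 by auto
      then have w: "w \<in> V" using differ_in_V[OF less.prems(1) yJ] by (cases "x w = y w") auto
      \<comment> \<open>at \<open>y\<close> the step helps \<open>u\<close>, hence harms \<open>w\<close>; so at \<open>x\<close> the opposite step helps \<open>w\<close>\<close>
      have "m \<le> m - pen1 u (y u) + pen1 u (y u - 1) - pen1 w (y w) + pen1 w (y w - t)"
        using minimum[OF yJ'] pen_shift2[OF u(1) w False, of y "-1" "-t"] ym by simp
      moreover have "pen1 u (y u - 1) = pen1 u (y u) - 1"
        using over u(2) low_le_high[of u] by (auto simp: penalty_def)
      moreover have "pen1 w (x w + t) - pen1 w (x w) \<le> pen1 w (y w) - pen1 w (y w - t)"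
        using penalty_convex[OF t gap low_le_high] by simp
      ultimately have "pen1 w (x w + t) \<le> pen1 w (x w) - 1" by simp
      moreover have "?pen' (shift (shift x u 1) w t) =
          pen x - pen1 u (x u) - pen1 w (x w) + pen1 w (x w + t) + (x u + 1 - h u)"
        unfolding pen' pen_shift2[OF u(1) w False] using False by (simp add: shift_def)
      ultimately have "?pen' (shift (shift x u 1) w t) < m"
        using less.prems(2) unfolding pen' by simp
      moreover have "shift (shift x u 1) w t u = x u + 1" using False by (simp add: shift_def)
      ultimately show False using less.hyps[OF _ xJ] below by simp
    qed
  qed
  then show False using saturated[of u 1] u by auto
qed

lemma under_step:
  assumes u: "u \<in> V" "c u = 0" and y: "y \<in> optimal" and under: "y u < l u"
  shows "y u = l u - 1 \<and> l u = h u \<and> shift y u 2 \<in> optimal"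
proof -
  interpret r: saturated V "(\<lambda>x v. - x v) ` J" "\<lambda>v. - h v" "\<lambda>v. - l v" "\<lambda>v. - c v" m
    by (rule reflect)
  have opt: "(\<lambda>v. - x v) \<in> r.optimal \<longleftrightarrow> x \<in> optimal" for x
  proof -
    have "(\<lambda>v. - x v) \<in> (\<lambda>x v. - x v) ` J \<longleftrightarrow> x \<in> J"
      by (auto simp: fun_eq_iff image_iff) (metis ext minus_equation_iff neg_equal_iff_equal)
    then show ?thesis by (simp add: r.optimal_def optimal_def total_penalty_reflect)
  qed
  have "- y u = - l u + 1 \<and> - h u = - l u \<and> shift (\<lambda>v. - y v) u (-2) \<in> r.optimal"
    using u y under by (intro r.over_step) (auto simp: opt)
  moreover have "shift (\<lambda>v. - y v) u (-2) = (\<lambda>v. - shift y u 2 v)"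
    by (auto simp: shift_def)
  ultimately show ?thesis by (auto simp: opt)
qed

end

section \<open>Optimal edge sets deviate at most once per component\<close>

definition neighbours :: "('e \<Rightarrow> 'v) \<Rightarrow> ('e \<Rightarrow> 'v) \<Rightarrow> 'e set \<Rightarrow> 'v set \<Rightarrow> ('v \<times> 'v) set" where
  "neighbours a b E R =
     {(u, v). u \<in> R \<and> v \<in> R \<and> (\<exists>e\<in>E. (a e = u \<and> b e = v) \<or> (a e = v \<and> b e = u))}"

lemma sym_neighbours: "sym (neighbours a b E R)"
  by (auto simp: sym_def neighbours_def)

text \<open>
  From here on the exchangeable set consists of the degree vectors of a graph. Besides exchanges in
  \<open>E\<close>, this allows exchanges in \<open>E - {e}\<close> and the addition or removal of single edges.
\<close>

locale saturated_graph = saturated V "degree_vectors a b E" l h c m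
  for V :: "'v set" and E :: "'e set" and a b :: "'e \<Rightarrow> 'v" and l h c :: "'v \<Rightarrow> int" and m :: int +
  assumes finite_E: "finite E"
    and ends_in_V: "e \<in> E \<Longrightarrow> a e \<in> V" "e \<in> E \<Longrightarrow> b e \<in> V"
    and c_range: "c v = 0 \<or> c v = 1 \<or> c v = -1"
begin

definition "S = {v \<in> V. c v = 1}"
definition "T = {v \<in> V. c v = -1}"
definition "R = {v \<in> V. c v = 0}"

abbreviation "nbr \<equiv> neighbours a b E R"

definition "dev x v = penalty 0 (l v) (h v) (x v)"

lemma dev_nonneg: "0 \<le> dev x v" by (simp add: dev_def penalty_def)

lemma RD: "v \<in> R \<Longrightarrow> v \<in> V" "v \<in> R \<Longrightarrow> c v = 0" by (auto simp: R_def)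

lemma deviation_step:
  assumes "u \<in> R" "x \<in> optimal" "dev x u \<noteq> 0"
  obtains s where "\<bar>s\<bar> = 1" "x u = h u + s" "l u = h u" "shift x u (-2 * s) \<in> optimal"
proof (cases "h u < x u")
  case True
  then show thesis using over_step[OF RD[OF assms(1)] assms(2)] that[of 1] by auto
next
  case False
  then have "x u < l u" using assms(3) by (auto simp: dev_def penalty_def)
  then show thesis using under_step[OF RD[OF assms(1)] assms(2)] that[of "-1"] by auto
qed

lemma deviation_le_1:
  assumes "u \<in> R" "x \<in> optimal" shows "dev x u \<le> 1"
proof (cases "dev x u = 0")
  case False
  with assms obtain s where "\<bar>s\<bar> = 1" "x u = h u + s" "l u = h u" by (rule deviation_step)
  then show ?thesis by (auto simp: dev_def penalty_def)
qed simp

text \<open>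
  The excess at \<open>u\<close> can be passed on along an edge \<open>uv\<close>. By \<open>over_step\<close> the vectors \<open>x\<close> and
  \<open>x - 2u\<close> are both degree vectors. If \<open>e\<close> can be removed from an edge set realising \<open>x\<close>, or added
  to one realising \<open>x - 2u\<close>, this is clear; otherwise the exchange property is used in the graph
  without \<open>e\<close>.
\<close>

lemma push_across_edge:
  assumes x: "x \<in> optimal" and u: "u \<in> R" and over: "h u < x u"
    and e: "e \<in> E" "(a e = u \<and> b e = v) \<or> (a e = v \<and> b e = u)" and "u \<noteq> v"
  shows "\<exists>t. \<bar>t\<bar> = 1 \<and> shift (shift x u (-1)) v t \<in> degree_vectors a b E"
proof -
  have y: "shift x u (-2) \<in> optimal" using over_step[OF RD[OF u] x over] by simp
  obtain F F' where F: "F \<subseteq> E" "x = edeg a b F" and F': "F' \<subseteq> E" "shift x u (-2) = edeg a b F'"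
    using x y unfolding optimal_def mem_Collect_eq by (metis degree_vectors_def imageE PowD)
  have fin: "finite F" "finite F'" using F F' finite_E finite_subset by auto
  have remove: "edeg a b (H - {e}) = shift (shift (edeg a b H) u (-1)) v (-1)"
    if "e \<in> H" "H \<subseteq> E" for H
    using edeg_remove[of H e a b] that e finite_subset[OF that(2) finite_E]
      shift_commute[of "edeg a b H" u "-1" v "-1"] by auto
  have add: "edeg a b (insert e H) = shift (shift (edeg a b H) u 1) v 1"
    if "e \<notin> H" "H \<subseteq> E" for H
    using edeg_insert[of H e a b] that e finite_subset[OF that(2) finite_E]
      shift_commute[of "edeg a b H" u 1 v 1] by auto
  have inJ: "edeg a b H \<in> degree_vectors a b E" if "H \<subseteq> E" for H
    using that by (auto simp: degree_vectors_def)
  consider "e \<in> F" | "e \<notin> F'" | "e \<notin> F" "e \<in> F'" by blast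
  then show ?thesis
  proof cases
    case 1
    then show ?thesis using remove[of F] F inJ[of "F - {e}"] by (intro exI[of _ "-1"]) auto
  next
    case 2
    have "shift (shift (shift x u (-2)) u 1) v 1 = shift (shift x u (-1)) v 1"
      by (simp add: shift_shift)
    then show ?thesis using add[of F'] 2 F' e inJ[of "insert e F'"] by (intro exI[of _ 1]) auto
  next
    case 3
    \<comment> \<open>\<open>x\<close> and \<open>?y\<close> differ only at \<open>u\<close> and \<open>v\<close>, which leaves just two possibilities for the exchange\<close>
    let ?y = "edeg a b (F' - {e})"
    have yd: "?y = shift (shift x u (-3)) v (-1)"
      unfolding remove[OF 3(2) F'(1)] F'(2)[symmetric] by (simp add: shift_shift)
    have xE: "x \<in> degree_vectors a b (E - {e})" and yE: "?y \<in> degree_vectors a b (E - {e})"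
      using F F' 3 by (auto simp: degree_vectors_def)
    have "0 < -1 * (?y u - x u)" unfolding yd using \<open>u \<noteq> v\<close> by (simp add: shift_def)
    then obtain w t where t: "\<bar>t\<bar> = 1"
      and xJ: "shift (shift x u (-1)) w t \<in> degree_vectors a b (E - {e})"
      and cond: "if w = u then t = -1 \<and> 2 \<le> -1 * (?y u - x u) else 0 < t * (?y w - x w)"
      using exchangeable_degree_vectors[OF finite_Diff[OF finite_E], of a b "{e}"] xE yE
      unfolding exchangeable_def by (metis abs_neg_one)
    show ?thesis
    proof (cases "w = u")
      case True
      then have "shift x u (-2) \<in> degree_vectors a b (E - {e})"
        using xJ cond by (simp add: shift_shift)
      then obtain H where H: "H \<subseteq> E - {e}" "shift x u (-2) = edeg a b H"
        by (auto simp: degree_vectors_def)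
      have "e \<notin> H" "H \<subseteq> E" using H by auto
      then have "shift (shift x u (-1)) v 1 = edeg a b (insert e H)"
        unfolding add[OF \<open>e \<notin> H\<close> \<open>H \<subseteq> E\<close>] H(2)[symmetric] by (simp add: shift_shift)
      then show ?thesis using inJ[of "insert e H"] e \<open>H \<subseteq> E\<close> by (intro exI[of _ 1]) auto
    next
      case False
      then have "w = v" using cond unfolding yd by (auto simp: shift_def split: if_splits)
      then show ?thesis using xJ t by (auto simp: degree_vectors_def)
    qed
  qed
qed

text \<open>
  Passing the excess of \<open>u\<close> on to \<open>v\<close> repairs \<open>u\<close>, so it must harm \<open>v\<close>. If \<open>v\<close> deviated already,
  it would then deviate by 2, which an optimal vector does not do.
\<close>

lemma neighbour_of_deviating:
  assumes x: "x \<in> optimal" and dev: "dev x u \<noteq> 0" and uv: "(u, v) \<in> nbr" and "u \<noteq> v"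
  shows "dev x v = 0 \<and> (\<exists>z\<in>optimal. dev z v \<noteq> 0)"
proof -
  from uv obtain e where u: "u \<in> R" and v: "v \<in> R" and e: "e \<in> E"
      "(a e = u \<and> b e = v) \<or> (a e = v \<and> b e = u)" by (auto simp: neighbours_def)
  \<comment> \<open>the deviation at \<open>u\<close> may be assumed to be an excess\<close>
  obtain x' where x': "x' \<in> optimal" "x' v = x v" "h u < x' u"
  proof (cases "h u < x u")
    case False
    then have "x u < l u" using dev by (auto simp: dev_def penalty_def)
    then show thesis using that[of "shift x u 2"] under_step[OF RD[OF u] x] \<open>u \<noteq> v\<close>
      by (auto simp: shift_def)
  qed (use that x in auto)
  obtain t where t: "\<bar>t\<bar> = 1" and z: "shift (shift x' u (-1)) v t \<in> degree_vectors a b E"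
    using push_across_edge[OF x'(1) u x'(3) e \<open>u \<noteq> v\<close>] by blast
  let ?z = "shift (shift x' u (-1)) v t"
  have "pen ?z = m - pen1 u (x' u) + pen1 u (x' u - 1) - pen1 v (x v) + pen1 v (x v + t)"
    using pen_shift2[OF RD(1)[OF u] RD(1)[OF v], of x' "-1" t] \<open>u \<noteq> v\<close> x'
    by (simp add: optimal_def)
  moreover have "pen1 u (x' u - 1) = pen1 u (x' u) - 1"
    using x'(3) RD[OF u] low_le_high[of u] by (auto simp: penalty_def)
  moreover have "pen1 v (x v + t) \<le> pen1 v (x v) + 1"
    using t penalty_step_le low_le_high by blast
  moreover have "m \<le> pen ?z" using minimum z by blast
  ultimately have "pen ?z = m" and up: "pen1 v (x v + t) = pen1 v (x v) + 1" by auto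
  then have zo: "?z \<in> optimal" using z by (simp add: optimal_def)
  have dz: "dev ?z v = dev x v + 1"
    using up RD[OF v] x'(2) \<open>u \<noteq> v\<close> by (simp add: dev_def shift_def)
  then have "dev x v = 0" using deviation_le_1[OF v zo] dev_nonneg[of x v] by linarith
  moreover have "dev ?z v \<noteq> 0" using dz dev_nonneg[of x v] by linarith
  ultimately show ?thesis using zo by blast
qed

text \<open>
  The analogue of Gallai's lemma, by induction on a path from \<open>u\<close> to \<open>v\<close> with second vertex \<open>p\<close>. An
  optimal \<open>x\<close> that deviates at \<open>u\<close> and \<open>v\<close> is exchanged at \<open>u\<close> with an optimal \<open>y\<close> that deviates at
  \<open>p\<close>. If the second step is made at \<open>p\<close>, the new \<open>x\<close> deviates at \<open>p\<close> and \<open>v\<close>, which are closer;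
  otherwise the new \<open>y\<close> deviates at the adjacent vertices \<open>u\<close> and \<open>p\<close>.
\<close>

lemma single_deviation:
  assumes "(u, v) \<in> nbr\<^sup>*" "x \<in> optimal" "u \<noteq> v" "dev x u \<noteq> 0"
  shows "dev x v = 0"
  using assms
proof (induction arbitrary: x rule: converse_rtrancl_induct)
  case (step u p)
  show ?case
  proof (rule ccontr)
    assume devv: "dev x v \<noteq> 0"
    have u: "u \<in> R" and p: "p \<in> R" using step.hyps(1) by (auto simp: neighbours_def)
    have pu: "(p, u) \<in> nbr" using step.hyps(1) sym_neighbours[of a b E R] by (auto simp: sym_def)
    have "u \<noteq> p" using step devv by blast
    have "p \<noteq> v" using neighbour_of_deviating[OF step.prems(1,3) step.hyps(1) \<open>u \<noteq> p\<close>] devv by auto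
    obtain y where y: "y \<in> optimal" "dev y p \<noteq> 0"
      using neighbour_of_deviating[OF step.prems(1,3) step.hyps(1) \<open>u \<noteq> p\<close>] by blast
    have yu: "dev y u = 0" using neighbour_of_deviating[OF y pu] \<open>u \<noteq> p\<close> by auto
    obtain s where s: "\<bar>s\<bar> = 1" "x u = h u + s" "l u = h u"
      using deviation_step[OF u step.prems(1,3)] by metis
    have yuh: "y u = h u" using yu s by (auto simp: dev_def penalty_def)
    have xJ: "x \<in> degree_vectors a b E" and yJ: "y \<in> degree_vectors a b E"
      using y step.prems(1) by (auto simp: optimal_def)
    have s1: "\<bar>- s\<bar> = 1" and gap_u: "0 < - s * (y u - x u)"
      using s(2) yuh s(1)[unfolded abs_eq_iff'] by auto
    obtain w t where t: "\<bar>t\<bar> = 1"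
      and x': "shift (shift x u (-s)) w t \<in> degree_vectors a b E"
      and y': "shift (shift y u (-(-s))) w (-t) \<in> degree_vectors a b E"
      and far: "w = u \<Longrightarrow> 2 \<le> -s * (y u - x u)" and cond: "w \<noteq> u \<Longrightarrow> 0 < t * (y w - x w)"
      using exchangeD[OF xJ yJ s1 gap_u] by metis
    \<comment> \<open>\<open>x u\<close> and \<open>y u\<close> differ by 1 only, so the exchange is not a double step\<close>
    have wu: "w \<noteq> u" using far s(2) yuh s(1)[unfolded abs_eq_iff'] by auto
    then have gap: "0 < t * (y w - x w)" by (rule cond)
    have w: "w \<in> V" using differ_in_V[OF xJ yJ] gap by (cases "x w = y w") auto
    have uV: "u \<in> V" "c u = 0" using RD[OF u] by auto
    have drop: "pen1 u (x u - s) = pen1 u (x u) - 1" and rise: "pen1 u (y u + s) = pen1 u (y u) + 1"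
      using s yuh uV by (auto simp: penalty_def)
    have px: "pen (shift (shift x u (-s)) w t) = m - 1 - pen1 w (x w) + pen1 w (x w + t)"
      using pen_shift2[OF uV(1) w wu, of x "-s" t] drop step.prems(1) by (simp add: optimal_def)
    have py: "pen (shift (shift y u s) w (-t)) = m + 1 - pen1 w (y w) + pen1 w (y w - t)"
      using pen_shift2[OF uV(1) w wu, of y s "-t"] rise y(1) by (simp add: optimal_def)
    have "pen1 w (x w + t) \<ge> pen1 w (x w) + 1" using px minimum[OF x'] by simp
    moreover have "pen1 w (x w + t) - pen1 w (x w) \<le> pen1 w (y w) - pen1 w (y w - t)"
      using penalty_convex[OF t gap low_le_high] by simp
    moreover have "pen1 w (x w + t) \<le> pen1 w (x w) + 1" by (rule penalty_step_le[OF t low_le_high])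
    moreover have "m \<le> pen (shift (shift y u s) w (-t))" using minimum y' by simp
    ultimately have xo: "shift (shift x u (-s)) w t \<in> optimal"
      and yo: "shift (shift y u s) w (-t) \<in> optimal"
      and up: "pen1 w (x w + t) = pen1 w (x w) + 1"
      using px py x' y' by (auto simp: optimal_def)
    show False
    proof (cases "w = p")
      case True
      have "dev (shift (shift x u (-s)) w t) p = dev x p + 1"
        using up True RD[OF p] wu by (simp add: dev_def shift_def)
      then have "dev (shift (shift x u (-s)) w t) p \<noteq> 0" using dev_nonneg[of x p] by simp
      then have "dev (shift (shift x u (-s)) w t) v = 0"
        using step.IH[OF xo \<open>p \<noteq> v\<close>] by simp
      moreover have "dev (shift (shift x u (-s)) w t) v = dev x v"
        using True \<open>p \<noteq> v\<close> step.prems(2) by (simp add: dev_def shift_def)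
      ultimately show False using devv by simp
    next
      case False
      let ?y = "shift (shift y u s) w (-t)"
      have "dev ?y u \<noteq> 0" using s yuh wu by (auto simp: dev_def shift_def penalty_def)
      moreover have "dev ?y p \<noteq> 0" using False \<open>u \<noteq> p\<close> y(2) by (simp add: dev_def shift_def)
      ultimately show False
        using neighbour_of_deviating[OF yo _ step.hyps(1) \<open>u \<noteq> p\<close>] by simp
    qed
  qed
qed simp

end

section \<open>Weights of edges between vertex sets\<close>

text \<open>
  For \<open>X = Y\<close> every edge is counted twice. With this convention the weight is symmetric
  and additive in both arguments, and \<open>Y = V\<close> gives the sum of the weighted degrees over \<open>X\<close>.
\<close>

definition edge_weight ::
    "('e \<Rightarrow> 'v) \<Rightarrow> ('e \<Rightarrow> 'v) \<Rightarrow> 'e set \<Rightarrow> ('e \<Rightarrow> 'r::comm_ring_1) \<Rightarrow> 'v set \<Rightarrow> 'v set \<Rightarrow> 'r" where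
  "edge_weight a b E w X Y =
     (\<Sum>e\<in>E. w e * (of_bool (a e \<in> X \<and> b e \<in> Y) + of_bool (b e \<in> X \<and> a e \<in> Y)))"

lemma edge_weight_commute: "edge_weight a b E w X Y = edge_weight a b E w Y X"
  unfolding edge_weight_def by (intro sum.cong refl) (simp add: conj_commute add.commute)

lemma edge_weight_Un_right:
  "Y \<inter> Z = {} \<Longrightarrow> edge_weight a b E w X (Y \<union> Z) = edge_weight a b E w X Y + edge_weight a b E w X Z"
  unfolding edge_weight_def sum.distrib[symmetric] by (intro sum.cong refl) auto

lemma edge_weight_Un_left:
  "Y \<inter> Z = {} \<Longrightarrow> edge_weight a b E w (Y \<union> Z) X = edge_weight a b E w Y X + edge_weight a b E w Z X"
  using edge_weight_Un_right[of Y Z a b E w X] by (simp add: edge_weight_commute)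

lemma edge_weight_empty [simp]: "edge_weight a b E w X {} = 0" "edge_weight a b E w {} X = 0"
  by (simp_all add: edge_weight_def)

lemma edge_weight_Union_right:
  assumes "finite \<K>" "pairwise disjnt \<K>"
  shows "edge_weight a b E w X (\<Union>\<K>) = (\<Sum>K\<in>\<K>. edge_weight a b E w X K)"
  using assms
proof (induction rule: finite_induct)
  case (insert K \<K>)
  then have "K \<inter> \<Union>\<K> = {}" by (auto simp: pairwise_insert disjnt_def)
  then show ?case using insert by (simp add: edge_weight_Un_right pairwise_insert)
qed simp

lemma sum_edge_weight_singletons:
  assumes "finite X"
  shows "(\<Sum>v\<in>X. edge_weight a b E w {v} Y) = edge_weight a b E w X Y"
  using assms
proof (induction rule: finite_induct)
  case (insert v X)
  then show ?case using edge_weight_Un_left[of "{v}" X a b E w Y] by simp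
qed simp

lemma edge_weight_add:
  "edge_weight a b E (\<lambda>e. w e + w' e) X Y = edge_weight a b E w X Y + edge_weight a b E w' X Y"
  by (simp add: edge_weight_def sum.distrib distrib_right)

lemma edge_weight_nonneg:
  fixes w :: "'e \<Rightarrow> 'r::linordered_idom"
  shows "(\<And>e. e \<in> E \<Longrightarrow> 0 \<le> w e) \<Longrightarrow> 0 \<le> edge_weight a b E w X Y"
  unfolding edge_weight_def by (intro sum_nonneg mult_nonneg_nonneg) auto

lemma edge_weight_mono:
  fixes w :: "'e \<Rightarrow> 'r::linordered_idom"
  assumes "\<And>e. e \<in> E \<Longrightarrow> 0 \<le> w e" "\<And>e. e \<in> E \<Longrightarrow> w e \<le> w' e" "X \<subseteq> X'" "Y \<subseteq> Y'"
  shows "edge_weight a b E w X Y \<le> edge_weight a b E w' X' Y'"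
  unfolding edge_weight_def using assms by (intro sum_mono mult_mono) (auto intro: order_trans)

lemma edge_weight_same:
  "edge_weight a b E w X X = 2 * (\<Sum>e\<in>E. w e * of_bool (a e \<in> X \<and> b e \<in> X))"
  unfolding edge_weight_def sum_distrib_left by (intro sum.cong refl) (auto simp: conj_commute)

lemma even_edge_weight_same: "even (edge_weight a b E (w :: 'e \<Rightarrow> int) X X)"
  by (simp add: edge_weight_same)

lemma edge_weight_eq_0_iff:
  assumes "finite E" "\<And>e. e \<in> E \<Longrightarrow> 0 \<le> (w e :: int)"
  shows "edge_weight a b E w X Y = 0 \<longleftrightarrow>
    (\<forall>e\<in>E. w e \<noteq> 0 \<longrightarrow> \<not> (a e \<in> X \<and> b e \<in> Y) \<and> \<not> (b e \<in> X \<and> a e \<in> Y))"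
  unfolding edge_weight_def using assms
  by (subst sum_nonneg_eq_0_iff) (auto simp: of_bool_def)

lemma edeg_eq_edge_weight:
  assumes "finite E" "F \<subseteq> E" "\<And>e. e \<in> E \<Longrightarrow> a e \<in> V \<and> b e \<in> V"
  shows "edeg a b F v = edge_weight a b E (\<lambda>e. of_bool (e \<in> F)) {v} V"
  unfolding edeg_def edge_weight_def using assms
  by (intro sum.mono_neutral_cong_left) auto

lemma sum_edeg:
  assumes "finite E" "F \<subseteq> E" "\<And>e. e \<in> E \<Longrightarrow> a e \<in> V \<and> b e \<in> V" "finite X"
  shows "(\<Sum>v\<in>X. edeg a b F v) = edge_weight a b E (\<lambda>e. of_bool (e \<in> F)) X V"
proof -
  have "(\<Sum>v\<in>X. edeg a b F v) = (\<Sum>v\<in>X. edge_weight a b E (\<lambda>e. of_bool (e \<in> F)) {v} V)"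
    by (intro sum.cong refl edeg_eq_edge_weight assms)
  then show ?thesis using sum_edge_weight_singletons[OF assms(4)] by metis
qed

section \<open>Wrong edges and the defect of a component\<close>

context saturated_graph
begin

abbreviation "block u \<equiv> {v. (u, v) \<in> nbr\<^sup>*}"

lemma block_subset: "u \<in> R \<Longrightarrow> block u \<subseteq> R"
proof
  fix v assume "u \<in> R" "v \<in> block u"
  then have "(u, v) \<in> nbr\<^sup>*" by simp
  then show "v \<in> R" using \<open>u \<in> R\<close> by (cases rule: rtranclE) (auto simp: neighbours_def)
qed

lemma nbr_rtrancl_sym: "(u, v) \<in> nbr\<^sup>* \<Longrightarrow> (v, u) \<in> nbr\<^sup>*"
  using sym_rtrancl[OF sym_neighbours] by (metis symD)

lemma block_eq:
  assumes "v \<in> block u" shows "block v = block u"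
proof -
  have uv: "(u, v) \<in> nbr\<^sup>*" and vu: "(v, u) \<in> nbr\<^sup>*" using assms nbr_rtrancl_sym[of u v] by simp_all
  show ?thesis using rtrancl_trans[OF uv] rtrancl_trans[OF vu] by blast
qed

lemma S_T_R: "S \<inter> T = {}" "S \<inter> R = {}" "T \<inter> R = {}" "V = S \<union> (T \<union> R)" "finite S" "finite T" "finite R"
  using c_range finite_V by (auto simp: S_def T_def R_def)

lemma pen_shift_S: "u \<in> S \<Longrightarrow> pen (shift x u s) = pen x + s"
  by (subst pen_shift) (auto simp: S_def penalty_def)

lemma pen_shift_T: "u \<in> T \<Longrightarrow> pen (shift x u s) = pen x - s"
  by (subst pen_shift) (auto simp: T_def penalty_def)

lemma pen_shift_R: "v \<in> R \<Longrightarrow> pen (shift x v s) = pen x - dev x v + dev (shift x v s) v"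
  by (subst pen_shift) (auto simp: R_def dev_def shift_def)

lemma J_I: "F \<subseteq> E \<Longrightarrow> edeg a b F \<in> degree_vectors a b E"
  by (auto simp: degree_vectors_def)

lemma finite_sub: "F \<subseteq> E \<Longrightarrow> finite F" using finite_E finite_subset by auto

lemma no_edge_in_S:
  assumes F: "F \<subseteq> E" "edeg a b F \<in> optimal" and "e \<in> F" shows "\<not> (a e \<in> S \<and> b e \<in> S)"
proof
  assume "a e \<in> S \<and> b e \<in> S"
  then have "pen (edeg a b (F - {e})) = m - 2"
    using F by (simp add: edeg_remove finite_sub \<open>e \<in> F\<close> pen_shift_S optimal_def)
  then show False using minimum[OF J_I[of "F - {e}"]] F by auto
qed

lemma all_edges_in_T:
  assumes F: "F \<subseteq> E" "edeg a b F \<in> optimal" and "e \<in> E - F" shows "\<not> (a e \<in> T \<and> b e \<in> T)"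
proof
  assume "a e \<in> T \<and> b e \<in> T"
  then have "pen (edeg a b (insert e F)) = m - 2"
    using F \<open>e \<in> E - F\<close> by (simp add: edeg_insert finite_sub pen_shift_T optimal_def)
  then show False using minimum[OF J_I[of "insert e F"]] F \<open>e \<in> E - F\<close> by auto
qed

text \<open>
  An optimal edge set would like to avoid edges at \<open>S\<close> and to contain the edges at \<open>T\<close>. The wrong
  edges are those between \<open>S \<union> T\<close> and \<open>K\<close> that violate this.
\<close>

definition "wrong_edges F K = {e \<in> E. \<exists>u v. ((a e = u \<and> b e = v) \<or> (a e = v \<and> b e = u)) \<and> v \<in> K \<and>
    (if e \<in> F then u \<in> S else u \<in> T)}"

text \<open>
  Flipping a wrong edge gains 1 at its end in \<open>S \<union> T\<close>, hence loses 1 at its end in \<open>K\<close>: it trades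
  the wrong edge for a deviation.
\<close>

lemma flip_wrong_edge:
  assumes F: "F \<subseteq> E" "edeg a b F \<in> optimal" and e: "e \<in> wrong_edges F K" and K: "K \<subseteq> R"
  obtains F' v where "F' = sym_diff F {e}" "F' \<subseteq> E" "edeg a b F' \<in> optimal" "v \<in> K"
    "dev (edeg a b F) v = 0" "dev (edeg a b F') v = 1"
    "\<forall>v'\<in>R. v' \<noteq> v \<longrightarrow> dev (edeg a b F') v' = dev (edeg a b F) v'"
proof -
  from e obtain u v where eE: "e \<in> E" and uv: "(a e = u \<and> b e = v) \<or> (a e = v \<and> b e = u)"
    and v: "v \<in> K" and wrong: "if e \<in> F then u \<in> S else u \<in> T"
    by (auto simp: wrong_edges_def)
  let ?F' = "sym_diff F {e}"
  have vR: "v \<in> R" using v K by auto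
  have sub: "?F' \<subseteq> E" using eE F by auto
  have "u \<noteq> v" using S_T_R wrong vR by (auto split: if_splits)
  obtain s where s: "\<bar>s\<bar> = 1" and d: "edeg a b ?F' = shift (shift (edeg a b F) u s) v s"
    and lower: "pen (shift (edeg a b F) u s) = m - 1"
  proof (cases "e \<in> F")
    case True
    then have "?F' = F - {e}" by auto
    then have "edeg a b ?F' = shift (shift (edeg a b F) u (-1)) v (-1)"
      using edeg_remove[OF finite_sub[OF F(1)] True, of a b] uv
        shift_commute[of "edeg a b F" u "-1" v "-1"] by auto
    moreover have "pen (shift (edeg a b F) u (-1)) = m - 1"
      using True wrong F pen_shift_S by (simp add: optimal_def)
    ultimately show thesis using that[of "-1"] by simp
  next
    case False
    then have "?F' = insert e F" by auto
    then have "edeg a b ?F' = shift (shift (edeg a b F) u 1) v 1"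
      using edeg_insert[OF finite_sub[OF F(1)] False, of a b] uv
        shift_commute[of "edeg a b F" u 1 v 1] by auto
    moreover have "pen (shift (edeg a b F) u 1) = m - 1"
      using False wrong F pen_shift_T by (simp add: optimal_def)
    ultimately show thesis using that[of 1] by simp
  qed
  have dv: "dev (edeg a b ?F') v \<le> dev (edeg a b F) v + 1"
    unfolding d dev_def using penalty_step_le[OF s low_le_high[of v]] \<open>u \<noteq> v\<close>
    by (simp add: shift_def)
  have "pen (edeg a b ?F') = m - 1 - dev (edeg a b F) v + dev (edeg a b ?F') v"
    unfolding d using pen_shift_R[OF vR, of "shift (edeg a b F) u s" s] lower \<open>u \<noteq> v\<close>
    by (simp add: dev_def shift_def)
  moreover have "m \<le> pen (edeg a b ?F')" using minimum J_I sub by blast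
  ultimately have opt: "edeg a b ?F' \<in> optimal" and dv1: "dev (edeg a b ?F') v = dev (edeg a b F) v + 1"
    using dv J_I[OF sub] by (auto simp: optimal_def)
  have "dev (edeg a b ?F') v \<le> 1" by (rule deviation_le_1[OF vR opt])
  then have "dev (edeg a b F) v = 0" using dv1 dev_nonneg[of "edeg a b F" v] by linarith
  moreover have "dev (edeg a b ?F') v' = dev (edeg a b F) v'" if "v' \<in> R" "v' \<noteq> v" for v'
  proof -
    have "u \<noteq> v'" using S_T_R wrong that by (auto split: if_splits)
    then show ?thesis using that unfolding d by (simp add: dev_def shift_def)
  qed
  ultimately show thesis using that[of ?F' v] sub opt v dv1 by auto
qed

lemma single_deviation_block:
  assumes "r \<in> R" "u \<in> block r" "v \<in> block r" "u \<noteq> v" "x \<in> optimal" "dev x u \<noteq> 0"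
  shows "dev x v = 0"
proof -
  have "(u, v) \<in> nbr\<^sup>*"
    using assms(2,3) nbr_rtrancl_sym[of r u] rtrancl_trans[of u r nbr v] by simp
  then show ?thesis using single_deviation assms by blast
qed

text \<open>
  Otherwise flipping the wrong edge would produce a second deviation in the same component.
\<close>

lemma wrong_edge_no_deviation:
  assumes F: "F \<subseteq> E" "edeg a b F \<in> optimal" and r: "r \<in> R"
    and e: "e \<in> wrong_edges F (block r)" and v: "v \<in> block r"
  shows "dev (edeg a b F) v = 0"
proof -
  obtain F' u where F': "F' = sym_diff F {e}" "F' \<subseteq> E" "edeg a b F' \<in> optimal" "u \<in> block r"
    "dev (edeg a b F) u = 0" "dev (edeg a b F') u = 1"
    "\<forall>v'\<in>R. v' \<noteq> u \<longrightarrow> dev (edeg a b F') v' = dev (edeg a b F) v'"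
    by (rule flip_wrong_edge[OF F e block_subset[OF r]]) blast
  show ?thesis
  proof (cases "v = u")
    case False
    have "v \<in> R" using block_subset[OF r] v by blast
    moreover have "dev (edeg a b F') v = 0"
      using single_deviation_block[OF r F'(4) v _ F'(3)] F'(6) False by simp
    ultimately show ?thesis using F'(7) False by simp
  qed (simp add: F'(5))
qed

text \<open>
  Wrong edges and deviations are interchangeable by \<open>flip_wrong_edge\<close>, so they are counted together.
\<close>

definition "defect F K = (\<Sum>v\<in>K. dev (edeg a b F) v) + int (card (wrong_edges F K))"

lemma sum_dev_block_le_1:
  assumes x: "x \<in> optimal" and r: "r \<in> R"
  shows "(\<Sum>v\<in>block r. dev x v) \<le> 1"
proof (cases "\<exists>u\<in>block r. dev x u \<noteq> 0")
  case True
  then obtain u where u: "u \<in> block r" "dev x u \<noteq> 0" by blast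
  have fin: "finite (block r)" using block_subset[OF r] S_T_R finite_subset by blast
  have "(\<Sum>v\<in>block r. dev x v) = (\<Sum>v\<in>{u}. dev x v)"
    using single_deviation_block[OF r u(1) _ _ x u(2)] u fin
    by (intro sum.mono_neutral_right) auto
  then show ?thesis using deviation_le_1[OF _ x, of u] u block_subset[OF r] by auto
next
  case False
  then have "(\<Sum>v\<in>block r. dev x v) = 0" by (intro sum.neutral) auto
  then show ?thesis by simp
qed

lemma finite_wrong_edges [simp]: "finite (wrong_edges F K)"
  using finite_E by (simp add: wrong_edges_def)

lemma defect_le_1:
  assumes F: "F \<subseteq> E" "edeg a b F \<in> optimal" and r: "r \<in> R"
  shows "defect F (block r) \<le> 1"
proof (cases "wrong_edges F (block r) = {}")
  case True
  then show ?thesis using sum_dev_block_le_1[OF F(2) r] by (simp add: defect_def)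
next
  case False
  have "e1 = e2" if e: "e1 \<in> wrong_edges F (block r)" "e2 \<in> wrong_edges F (block r)" for e1 e2
  proof (rule ccontr)
    assume "e1 \<noteq> e2"
    obtain F' u where F': "F' = sym_diff F {e1}" "F' \<subseteq> E" "edeg a b F' \<in> optimal" "u \<in> block r"
      "dev (edeg a b F) u = 0" "dev (edeg a b F') u = 1"
      "\<forall>v'\<in>R. v' \<noteq> u \<longrightarrow> dev (edeg a b F') v' = dev (edeg a b F) v'"
      by (rule flip_wrong_edge[OF F e(1) block_subset[OF r]]) blast
    have "e2 \<in> wrong_edges F' (block r)"
      using e(2) \<open>e1 \<noteq> e2\<close> unfolding F'(1) wrong_edges_def by auto
    then show False using wrong_edge_no_deviation[OF F'(2,3) r _ F'(4)] F'(6) by simp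
  qed
  then have "card (wrong_edges F (block r)) \<le> 1"
    using card_le_Suc0_iff_eq[OF finite_wrong_edges] by auto
  moreover have "(\<Sum>v\<in>block r. dev (edeg a b F) v) = 0"
    using False wrong_edge_no_deviation[OF F r] by (intro sum.neutral) auto
  ultimately show ?thesis by (simp add: defect_def)
qed

lemma deviating_optimum:
  assumes F: "F \<subseteq> E" "edeg a b F \<in> optimal" and r: "r \<in> R" and d: "defect F (block r) = 1"
  obtains x u where "x \<in> optimal" "u \<in> block r" "dev x u \<noteq> 0"
proof (cases "wrong_edges F (block r) = {}")
  case True
  then have "(\<Sum>v\<in>block r. dev (edeg a b F) v) \<noteq> 0" using d by (simp add: defect_def)
  then obtain v where "v \<in> block r" "dev (edeg a b F) v \<noteq> 0" by (meson sum.neutral)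
  then show thesis using that F by blast
next
  case False
  then obtain e where e: "e \<in> wrong_edges F (block r)" by blast
  obtain F' u where F': "F' = sym_diff F {e}" "F' \<subseteq> E" "edeg a b F' \<in> optimal" "u \<in> block r"
    "dev (edeg a b F) u = 0" "dev (edeg a b F') u = 1"
    "\<forall>v'\<in>R. v' \<noteq> u \<longrightarrow> dev (edeg a b F') v' = dev (edeg a b F) v'"
    by (rule flip_wrong_edge[OF F e block_subset[OF r]]) blast
  show thesis using that[OF F'(3,4)] F'(6) by simp
qed

lemma all_deviate:
  assumes "(u, v) \<in> nbr\<^sup>*" "x \<in> optimal" "dev x u \<noteq> 0"
  shows "\<exists>z\<in>optimal. dev z v \<noteq> 0"
  using assms
proof (induction rule: rtrancl_induct)
  case (step p q)
  then obtain z where z: "z \<in> optimal" "dev z p \<noteq> 0" by blast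
  show ?case
  proof (cases "p = q")
    case False
    then show ?thesis using neighbour_of_deviating[OF z step.hyps(2)] by blast
  qed (use z in blast)
qed blast

end

section \<open>Odd blocks and the factor theorem\<close>

lemma edge_weight_cong:
  "(\<And>e. e \<in> E \<Longrightarrow> w e = w' e) \<Longrightarrow> edge_weight a b E w X Y = edge_weight a b E w' X Y"
  unfolding edge_weight_def by (intro sum.cong refl) auto

text \<open>
  The components counted in the deficiency formula, where \<open>R\<close> is the complement of \<open>S \<union> T\<close>. The last
  conjunct says that \<open>K\<close> does not induce a bipartite graph.
\<close>

definition odd_block ::
    "('e \<Rightarrow> 'v) \<Rightarrow> ('e \<Rightarrow> 'v) \<Rightarrow> 'e set \<Rightarrow> ('v \<Rightarrow> int) \<Rightarrow> ('v \<Rightarrow> int) \<Rightarrow> 'v set \<Rightarrow> 'v set \<Rightarrow> 'v set \<Rightarrow> bool"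
  where
  "odd_block a b E l h R T K \<longleftrightarrow>
     K \<noteq> {} \<and> K \<subseteq> R \<and> (\<forall>v\<in>K. l v = h v) \<and>
     (\<forall>u\<in>K. \<forall>v\<in>K. (u, v) \<in> (neighbours a b E K)\<^sup>*) \<and>
     edge_weight a b E (\<lambda>_. 1::int) K (R - K) = 0 \<and>
     odd ((\<Sum>v\<in>K. h v) + edge_weight a b E (\<lambda>_. 1) K T) \<and>
     (\<forall>A B. A \<union> B = K \<longrightarrow> A \<inter> B = {} \<longrightarrow> edge_weight a b E (\<lambda>_. 1::int) A A = 0 \<longrightarrow>
        edge_weight a b E (\<lambda>_. 1::int) B B \<noteq> 0)"

lemma odd_blockD:
  assumes "odd_block a b E l h R T K"
  shows "K \<noteq> {}" "K \<subseteq> R" "\<forall>v\<in>K. l v = h v"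
    "\<forall>u\<in>K. \<forall>v\<in>K. (u, v) \<in> (neighbours a b E K)\<^sup>*"
    "edge_weight a b E (\<lambda>_. 1::int) K (R - K) = 0"
    "odd ((\<Sum>v\<in>K. h v) + edge_weight a b E (\<lambda>_. 1) K T)"
    "\<forall>A B. A \<union> B = K \<longrightarrow> A \<inter> B = {} \<longrightarrow> edge_weight a b E (\<lambda>_. 1::int) A A = 0 \<longrightarrow>
        edge_weight a b E (\<lambda>_. 1::int) B B \<noteq> 0"
  by (insert assms[unfolded odd_block_def]; elim conjE; assumption)+

context saturated_graph
begin

abbreviation "ew \<equiv> edge_weight a b E"
abbreviation chosen :: "'e set \<Rightarrow> 'e \<Rightarrow> int" where "chosen F \<equiv> (\<lambda>e. of_bool (e \<in> F))"
abbreviation rejected :: "'e set \<Rightarrow> 'e \<Rightarrow> int" where "rejected F \<equiv> (\<lambda>e. of_bool (e \<notin> F))"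
abbreviation all_edges :: "'e \<Rightarrow> int" where "all_edges \<equiv> (\<lambda>e. 1)"

lemma optimalE:
  assumes "z \<in> optimal" obtains F where "F \<subseteq> E" "z = edeg a b F"
proof -
  have "z \<in> degree_vectors a b E" using assms by (simp add: optimal_def)
  then show thesis using that by (auto simp: degree_vectors_def)
qed

lemma chosen_rejected: "ew all_edges X Y = ew (chosen F) X Y + ew (rejected F) X Y"
  unfolding edge_weight_add[symmetric] by (intro edge_weight_cong) auto

lemma ew_chosen_nonneg: "0 \<le> ew (chosen F) X Y" and ew_rejected_nonneg: "0 \<le> ew (rejected F) X Y"
  by (intro edge_weight_nonneg; simp)+

lemma ew_all_0_mono:
  assumes "ew all_edges X Y = 0" "X' \<subseteq> X" "Y' \<subseteq> Y" shows "ew (chosen F) X' Y' = 0"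
proof -
  have "ew (chosen F) X' Y' \<le> ew all_edges X Y"
    by (intro edge_weight_mono assms) auto
  then show ?thesis using assms(1) ew_chosen_nonneg[of F X' Y'] by linarith
qed

lemma card_wrong_edges:
  assumes "K \<subseteq> R"
  shows "int (card (wrong_edges F K)) = ew (chosen F) S K + ew (rejected F) T K"
proof -
  have "ew (chosen F) S K + ew (rejected F) T K = (\<Sum>e\<in>E. of_bool (e \<in> wrong_edges F K))"
    unfolding edge_weight_def sum.distrib[symmetric]
    using assms S_T_R(1-3) by (intro sum.cong refl) (auto simp: wrong_edges_def of_bool_def)
  also have "\<dots> = (\<Sum>e\<in>wrong_edges F K. 1)"
    using finite_E by (intro sum.mono_neutral_cong_right) (auto simp: wrong_edges_def)
  finally show ?thesis by simp
qed

lemma sum_edeg_split: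
  assumes "F \<subseteq> E" "X \<subseteq> V"
  shows "(\<Sum>v\<in>X. edeg a b F v) = ew (chosen F) X S + ew (chosen F) X T + ew (chosen F) X R"
proof -
  have "(\<Sum>v\<in>X. edeg a b F v) = ew (chosen F) X V"
    using sum_edeg[OF finite_E assms(1), of a V b X] ends_in_V assms finite_V finite_subset by blast
  also have "\<dots> = ew (chosen F) X S + (ew (chosen F) X T + ew (chosen F) X R)"
    using S_T_R(1-3) by (subst S_T_R(4), subst edge_weight_Un_right; simp add: Int_Un_distrib edge_weight_Un_right)
  finally show ?thesis by simp
qed

lemma block_closed:
  assumes "r \<in> R" shows "ew all_edges (block r) (R - block r) = 0"
proof -
  have "\<not> (p \<in> block r \<and> q \<in> R - block r)"
    if e: "e \<in> E" and pq: "(a e = p \<and> b e = q) \<or> (a e = q \<and> b e = p)" for e p q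
  proof
    assume *: "p \<in> block r \<and> q \<in> R - block r"
    then have "(p, q) \<in> nbr" using e pq block_subset[OF assms] by (auto simp: neighbours_def)
    then show False using * by (auto intro: rtrancl_into_rtrancl)
  qed
  then show ?thesis using finite_E by (subst edge_weight_eq_0_iff) auto
qed

lemma ew_block_R:
  assumes "r \<in> R" "X \<subseteq> block r" shows "ew (chosen F) X R = ew (chosen F) X (block r)"
proof -
  have R: "R = block r \<union> (R - block r)" using block_subset[OF assms(1)] by auto
  have "ew (chosen F) X R = ew (chosen F) X (block r) + ew (chosen F) X (R - block r)"
    by (subst R, subst edge_weight_Un_right) auto
  moreover have "ew (chosen F) X (R - block r) = 0"
    using ew_all_0_mono[OF block_closed[OF assms(1)] assms(2)] by blast
  ultimately show ?thesis by simp
qed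

lemma block_connected:
  assumes "r \<in> R" "u \<in> block r" "v \<in> block r"
  shows "(u, v) \<in> (neighbours a b E (block r))\<^sup>*"
proof -
  have "(u, v) \<in> nbr\<^sup>*" using assms(3) block_eq[OF assms(2)] by blast
  then show ?thesis
  proof (induction rule: rtrancl_induct)
    case (step p q)
    have "(r, p) \<in> nbr\<^sup>*" using assms(2) step.hyps(1) by (auto intro: rtrancl_trans)
    then have "p \<in> block r" "q \<in> block r" using step.hyps(2) by (auto intro: rtrancl_into_rtrancl)
    then have "(p, q) \<in> neighbours a b E (block r)" using step.hyps(2) by (auto simp: neighbours_def)
    with step.IH show ?case by (rule rtrancl_into_rtrancl)
  qed simp
qed

text \<open>
  Suppose that the component has colour classes \<open>A\<close> and \<open>B\<close>. A deviating optimum has no wrong edges, so its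
  edges between the component and \<open>S \<union> T\<close> are determined, and those inside contribute equally to
  both classes. Hence the difference of the degree sums over \<open>A\<close> and \<open>B\<close> is the same for all
  optima that deviate at \<open>u\<close>, although turning over the deviation changes it by 2.
\<close>

lemma block_not_bipartite:
  assumes r: "r \<in> R" and x: "x \<in> optimal" and u: "u \<in> block r" "dev x u \<noteq> 0"
    and AB: "A \<union> B = block r" "A \<inter> B = {}" "ew all_edges A A = 0" "ew all_edges B B = 0"
  shows False
proof -
  have uR: "u \<in> R" using block_subset[OF r] u by blast
  have K: "block r \<subseteq> R" by (rule block_subset[OF r])
  have fin: "finite A" "finite B" using AB(1) K S_T_R(7) by (metis finite_Un finite_subset)+
  have sub: "A \<subseteq> block r" "B \<subseteq> block r" using AB by auto
  have KV: "block r \<subseteq> V" using K RD(1) by blast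
  \<comment> \<open>the right-hand side does not depend on the optimum \<open>z\<close>\<close>
  have balance: "(\<Sum>v\<in>A. z v) - (\<Sum>v\<in>B. z v) = ew all_edges A T - ew all_edges B T"
    if z: "z \<in> optimal" "dev z u \<noteq> 0" for z
  proof -
    obtain F where F: "F \<subseteq> E" "z = edeg a b F" by (rule optimalE[OF z(1)])
    have "wrong_edges F (block r) = {}"
      using wrong_edge_no_deviation[OF F(1) _ r _ u(1)] z F(2) by blast
    then have "ew (chosen F) S (block r) + ew (rejected F) T (block r) = 0"
      using card_wrong_edges[OF K, of F] by simp
    then have 0: "ew (chosen F) S (block r) = 0" "ew (rejected F) T (block r) = 0"
      using ew_chosen_nonneg[of F S "block r"] ew_rejected_nonneg[of F T "block r"] by auto
    have part: "(\<Sum>v\<in>X. z v) = ew all_edges X T + ew (chosen F) X Y"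
      if XY: "X \<union> Y = block r" "X \<inter> Y = {}" "ew all_edges X X = 0" for X Y
    proof -
      have X: "X \<subseteq> block r" "X \<subseteq> V" using XY(1) KV by auto
      have "ew (chosen F) S X \<le> ew (chosen F) S (block r)"
        "ew (rejected F) T X \<le> ew (rejected F) T (block r)"
        using X by (auto intro!: edge_weight_mono)
      then have "ew (chosen F) X S = 0" "ew (rejected F) X T = 0"
        using 0 ew_chosen_nonneg[of F S X] ew_rejected_nonneg[of F T X]
        by (auto simp: edge_weight_commute)
      moreover have "ew (chosen F) X R = ew (chosen F) X X + ew (chosen F) X Y"
        unfolding ew_block_R[OF r X(1)] XY(1)[symmetric] using XY(2) by (rule edge_weight_Un_right)
      moreover have "ew (chosen F) X X = 0" using ew_all_0_mono[OF XY(3)] by blast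
      ultimately show ?thesis
        using sum_edeg_split[OF F(1) X(2)] chosen_rejected[of X T F] by (simp add: F(2))
    qed
    have "(\<Sum>v\<in>B. z v) = ew all_edges B T + ew (chosen F) B A"
      using part[of B A] AB by (simp add: Un_commute Int_commute)
    then show ?thesis using part[OF AB(1,2,3)] edge_weight_commute[of a b E "chosen F" A B] by simp
  qed
  obtain s where s: "\<bar>s\<bar> = 1" "x u = h u + s" "l u = h u" and y: "shift x u (-2 * s) \<in> optimal"
    by (rule deviation_step[OF uR x u(2)])
  let ?y = "shift x u (-2 * s)"
  have "dev ?y u \<noteq> 0" using s by (auto simp: dev_def penalty_def shift_def)
  then have eq: "(\<Sum>v\<in>A. x v) - (\<Sum>v\<in>B. x v) = (\<Sum>v\<in>A. ?y v) - (\<Sum>v\<in>B. ?y v)"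
    using balance[OF x u(2)] balance[OF y] by simp
  have add: "(\<Sum>v\<in>X. ?y v) = (\<Sum>v\<in>X. x v) + (if u \<in> X then -2 * s else 0)" if "finite X" for X
  proof -
    have "(\<Sum>v\<in>X. ?y v) = (\<Sum>v\<in>X. x v + (if v = u then -2 * s else 0))"
      by (intro sum.cong refl) (auto simp: shift_def)
    then show ?thesis using that by (simp add: sum.distrib)
  qed
  have "u \<in> A \<and> u \<notin> B \<or> u \<notin> A \<and> u \<in> B" using AB(1,2) u(1) by blast
  then show False using eq s(1) unfolding add[OF fin(1)] add[OF fin(2)] by auto
qed

text \<open>
  Some vertex of the component deviates in some optimum, hence every vertex does, which
  forces \<open>l = h\<close> there. Then the parity follows by counting degrees: modulo 2, the defect is the demand of the
  component plus the number of its edges to \<open>T\<close>.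
\<close>

lemma defect_1_imp_odd_block:
  assumes F: "F \<subseteq> E" "edeg a b F \<in> optimal" and r: "r \<in> R" and d: "defect F (block r) = 1"
  shows "odd_block a b E l h R T (block r)"
proof -
  let ?K = "block r"
  obtain x u where x: "x \<in> optimal" "u \<in> ?K" "dev x u \<noteq> 0"
    by (rule deviating_optimum[OF F r d])
  have K: "?K \<subseteq> R" by (rule block_subset[OF r])
  have lh: "l v = h v" if "v \<in> ?K" for v
  proof -
    have "(u, v) \<in> nbr\<^sup>*" using that block_eq[OF x(2)] by blast
    then obtain z where "z \<in> optimal" "dev z v \<noteq> 0" using all_deviate x by blast
    then show ?thesis using deviation_step that K by (metis subsetD)
  qed
  have "even (\<bar>i\<bar> + i)" for i :: int by (cases "0 \<le> i") auto
  then have "even (dev (edeg a b F) v + edeg a b F v + h v)" if "v \<in> ?K" for v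
    using lh[OF that] by (auto simp: dev_def penalty_def max_def)
  then have "even (\<Sum>v\<in>?K. dev (edeg a b F) v + edeg a b F v + h v)" by (rule dvd_sum)
  moreover have "(\<Sum>v\<in>?K. edeg a b F v) =
      ew (chosen F) ?K S + ew (chosen F) ?K T + ew (chosen F) ?K ?K"
    using sum_edeg_split[OF F(1), of ?K] K RD(1) unfolding ew_block_R[OF r order.refl] by blast
  moreover have "(\<Sum>v\<in>?K. dev (edeg a b F) v) + ew (chosen F) ?K S + ew (rejected F) ?K T = 1"
    using d card_wrong_edges[OF K, of F] unfolding defect_def by (simp add: edge_weight_commute)
  moreover have "even (ew (chosen F) ?K ?K)" by (rule even_edge_weight_same)
  moreover have "ew all_edges ?K T = ew (chosen F) ?K T + ew (rejected F) ?K T"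
    by (rule chosen_rejected)
  ultimately have "odd ((\<Sum>v\<in>?K. h v) + ew all_edges ?K T)"
    unfolding sum.distrib by presburger
  then show ?thesis
    unfolding odd_block_def using r K lh block_connected[OF r] block_closed[OF r]
      block_not_bipartite[OF r x] by blast
qed

text \<open>
  The minimum \<open>m\<close> is evaluated at one optimal edge set: no chosen edge lies inside \<open>S\<close>, no rejected edge lies
  inside \<open>T\<close>, and each component contributes its defect, which is 1 for the odd blocks in \<open>\<K>\<close> and 0 for
  the others.
\<close>

lemma odd_blocks_deficiency:
  assumes "optimal \<noteq> {}"
  obtains \<K> where "pairwise disjnt \<K>" "\<forall>K\<in>\<K>. odd_block a b E l h R T K"
    "(\<Sum>v\<in>S. h v) + (\<Sum>v\<in>T. edeg a b E v - l v) - ew all_edges S T = int (card \<K>) - m"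
proof -
  obtain F where F: "F \<subseteq> E" "edeg a b F \<in> optimal"
    using assms optimalE by (metis ex_in_conv)
  define \<B> where "\<B> = block ` R"
  define \<K> where "\<K> = {K \<in> \<B>. defect F K = 1}"
  have fin: "finite K" if K: "K \<in> \<B>" for K
  proof -
    have "K \<subseteq> R" using K block_subset by (auto simp: \<B>_def)
    then show ?thesis using S_T_R(7) by (rule finite_subset)
  qed
  have finB: "finite \<B>" using S_T_R(7) by (simp add: \<B>_def)
  have UB: "\<Union>\<B> = R" using block_subset by (auto simp: \<B>_def)
  have disj: "pairwise disjnt \<B>"
    unfolding \<B>_def pairwise_def disjnt_def
  proof (intro ballI impI, elim imageE, hypsubst)
    fix p q assume "block p \<noteq> block q"
    then show "block p \<inter> block q = {}" using block_eq by blast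
  qed
  have defect: "defect F K = of_bool (K \<in> \<K>)" if "K \<in> \<B>" for K
  proof -
    obtain r where "r \<in> R" "K = block r" using \<open>K \<in> \<B>\<close> by (auto simp: \<B>_def)
    then have "defect F K \<le> 1" using defect_le_1[OF F] by simp
    moreover have "0 \<le> defect F K"
      unfolding defect_def using dev_nonneg by (intro add_nonneg_nonneg sum_nonneg) auto
    ultimately show ?thesis using that by (auto simp: \<K>_def)
  qed
  have "(\<Sum>v\<in>R. dev (edeg a b F) v) + ew (chosen F) S R + ew (rejected F) T R = (\<Sum>K\<in>\<B>. defect F K)"
  proof -
    have "(\<Sum>v\<in>R. dev (edeg a b F) v) = (\<Sum>K\<in>\<B>. \<Sum>v\<in>K. dev (edeg a b F) v)"
      unfolding UB[symmetric] using fin disj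
      by (subst sum.Union_disjoint) (auto simp: pairwise_def disjnt_def)
    moreover have "ew w X R = (\<Sum>K\<in>\<B>. ew w X K)" for w :: "'e \<Rightarrow> int" and X
      unfolding UB[symmetric] by (rule edge_weight_Union_right[OF finB disj])
    moreover have "defect F K = (\<Sum>v\<in>K. dev (edeg a b F) v) + ew (chosen F) S K + ew (rejected F) T K"
      if "K \<in> \<B>" for K
      using card_wrong_edges[of K F] UB that unfolding defect_def by auto
    ultimately show ?thesis by (simp add: sum.distrib)
  qed
  also have "\<dots> = (\<Sum>K\<in>\<B>. of_bool (K \<in> \<K>))" by (intro sum.cong refl defect)
  also have "\<dots> = (\<Sum>K\<in>\<K>. 1)"
    using finB by (intro sum.mono_neutral_cong_right) (auto simp: \<K>_def)
  finally have R: "(\<Sum>v\<in>R. dev (edeg a b F) v) + ew (chosen F) S R + ew (rejected F) T R = int (card \<K>)"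
    by simp
  have sum_V: "sum g V = sum g S + (sum g T + sum g R)" for g :: "'v \<Rightarrow> int"
  proof -
    have "sum g (S \<union> (T \<union> R)) = sum g S + sum g (T \<union> R)"
      using S_T_R(1-3,5-7) by (intro sum.union_disjoint) auto
    also have "sum g (T \<union> R) = sum g T + sum g R"
      using S_T_R(3,6,7) by (intro sum.union_disjoint) auto
    finally show ?thesis unfolding S_T_R(4)[symmetric] .
  qed
  have "m = pen (edeg a b F)" using F by (simp add: optimal_def)
  also have "\<dots> = (\<Sum>v\<in>S. pen1 v (edeg a b F v)) + ((\<Sum>v\<in>T. pen1 v (edeg a b F v)) +
      (\<Sum>v\<in>R. pen1 v (edeg a b F v)))"
    unfolding total_penalty_def by (rule sum_V)
  also have "(\<Sum>v\<in>S. pen1 v (edeg a b F v)) = (\<Sum>v\<in>S. edeg a b F v) - (\<Sum>v\<in>S. h v)"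
    unfolding sum_subtractf[symmetric] by (intro sum.cong refl) (auto simp: S_def penalty_def)
  also have "(\<Sum>v\<in>T. pen1 v (edeg a b F v)) = (\<Sum>v\<in>T. l v) - (\<Sum>v\<in>T. edeg a b F v)"
    unfolding sum_subtractf[symmetric] by (intro sum.cong refl) (auto simp: T_def penalty_def)
  also have "(\<Sum>v\<in>R. pen1 v (edeg a b F v)) = (\<Sum>v\<in>R. dev (edeg a b F) v)"
    by (intro sum.cong refl) (auto simp: R_def dev_def)
  finally have m: "m = (\<Sum>v\<in>S. edeg a b F v) - (\<Sum>v\<in>S. h v) +
      ((\<Sum>v\<in>T. l v) - (\<Sum>v\<in>T. edeg a b F v) + (\<Sum>v\<in>R. dev (edeg a b F) v))" .
  have sub: "S \<subseteq> V" "T \<subseteq> V" by (auto simp: S_def T_def)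
  have SS: "ew (chosen F) S S = 0"
    using no_edge_in_S[OF F] finite_E by (subst edge_weight_eq_0_iff) auto
  have TT: "ew (rejected F) T T = 0"
    using all_edges_in_T[OF F] finite_E by (subst edge_weight_eq_0_iff) auto
  have "(\<Sum>v\<in>T. edeg a b E v) = ew all_edges T S + ew all_edges T T + ew all_edges T R"
  proof -
    have "ew (chosen E) X Y = ew all_edges X Y" for X Y by (intro edge_weight_cong) auto
    then show ?thesis using sum_edeg_split[OF order.refl sub(2)] by simp
  qed
  then have "(\<Sum>v\<in>S. h v) + (\<Sum>v\<in>T. edeg a b E v - l v) - ew all_edges S T = int (card \<K>) - m"
    using m R SS TT sum_edeg_split[OF F(1) sub(1)] sum_edeg_split[OF F(1) sub(2)]
      chosen_rejected[of T S F] chosen_rejected[of T T F] chosen_rejected[of T R F]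
      chosen_rejected[of S T F] edge_weight_commute[of a b E "chosen F" S T]
      edge_weight_commute[of a b E "rejected F" S T]
    by (simp add: sum_subtractf)
  moreover have "\<forall>K\<in>\<K>. odd_block a b E l h R T K"
    using defect_1_imp_odd_block[OF F] by (auto simp: \<K>_def \<B>_def)
  moreover have "pairwise disjnt \<K>" using disj by (rule pairwise_subset) (auto simp: \<K>_def)
  ultimately show thesis using that by blast
qed

end

text \<open>
  Lovasz's \<open>(l, h)\<close>-factor theorem, in the direction that produces an obstruction, with the
  additional information that the odd blocks are not bipartite.
\<close>

theorem factor_theorem:
  fixes a b :: "'e \<Rightarrow> 'v" and l h :: "'v \<Rightarrow> int"
  assumes V: "finite V" and E: "finite E" and ends: "\<And>e. e \<in> E \<Longrightarrow> a e \<in> V \<and> b e \<in> V"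
    and lh: "\<And>v. l v \<le> h v"
    and none: "\<not> (\<exists>F\<subseteq>E. \<forall>v\<in>V. l v \<le> edeg a b F v \<and> edeg a b F v \<le> h v)"
  obtains S T \<K> where "S \<subseteq> V" "T \<subseteq> V" "S \<inter> T = {}" "pairwise disjnt \<K>"
    "\<forall>K\<in>\<K>. odd_block a b E l h (V - S - T) T K"
    "(\<Sum>v\<in>S. h v) + (\<Sum>v\<in>T. edeg a b E v - l v) - edge_weight a b E (\<lambda>_. 1) S T < int (card \<K>)"
proof -
  let ?J = "degree_vectors a b E" and ?pen = "total_penalty V l h"
  have finJ: "finite ?J" "?J \<noteq> {}" using E by (auto simp: degree_vectors_def)
  define m where "m = Min (?pen (\<lambda>_. 0) ` ?J)"
  have m_le: "m \<le> ?pen (\<lambda>_. 0) x" if "x \<in> ?J" for x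
    unfolding m_def using finJ that by (intro Min_le) auto
  have "m \<in> ?pen (\<lambda>_. 0) ` ?J" unfolding m_def using finJ by (intro Min_in) auto
  then obtain x0 where x0: "x0 \<in> ?J" "?pen (\<lambda>_. 0) x0 = m" by auto
  have "0 < m"
  proof (rule ccontr)
    assume "\<not> ?thesis"
    have nn: "0 \<le> penalty 0 (l v) (h v) (x0 v)" for v by (simp add: penalty_def)
    then have "0 \<le> ?pen (\<lambda>_. 0) x0" unfolding total_penalty_def by (intro sum_nonneg) auto
    then have "?pen (\<lambda>_. 0) x0 = 0" using x0(2) \<open>\<not> 0 < m\<close> by linarith
    then have "\<forall>v\<in>V. penalty 0 (l v) (h v) (x0 v) = 0"
      unfolding total_penalty_def using V nn by (subst (asm) sum_nonneg_eq_0_iff) auto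
    then have "\<forall>v\<in>V. l v \<le> x0 v \<and> x0 v \<le> h v" by (auto simp: penalty_def max_def split: if_splits)
    then show False using none x0(1) by (auto simp: degree_vectors_def)
  qed
  \<comment> \<open>as many marks as possible, subject to the minimum staying at \<open>m\<close>\<close>
  define P where "P c \<longleftrightarrow> (\<forall>v. c v = 0 \<or> c v = 1 \<or> c v = (-1::int)) \<and> (\<forall>x\<in>?J. m \<le> ?pen c x)" for c
  have "P (\<lambda>_. 0)" using m_le by (simp add: P_def)
  moreover have "\<forall>c. P c \<longrightarrow> card {v \<in> V. c v \<noteq> 0} < Suc (card V)"
    using V by (auto simp: less_Suc_eq_le intro: card_mono)
  ultimately obtain c where c: "P c" "\<And>c'. P c' \<Longrightarrow> card {v \<in> V. c' v \<noteq> 0} \<le> card {v \<in> V. c v \<noteq> 0}"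
    using ex_has_greatest_nat[of P "\<lambda>_. 0" "\<lambda>c. card {v \<in> V. c v \<noteq> 0}" "Suc (card V)"] by blast
  interpret saturated_graph V E a b l h c m
  proof
    fix x v assume "x \<in> ?J" "v \<notin> V"
    then obtain F where F: "F \<subseteq> E" "x = edeg a b F" by (auto simp: degree_vectors_def)
    show "x v = 0" unfolding F(2) edeg_def
      using F(1) ends \<open>v \<notin> V\<close> by (intro sum.neutral) auto
  next
    fix u and k :: int assume u: "u \<in> V" "c u = 0" and k: "\<bar>k\<bar> = 1"
    have "k \<noteq> 0" "k = 1 \<or> k = -1" using k by linarith+
    then have "{v \<in> V. (c(u := k)) v \<noteq> 0} = insert u {v \<in> V. c v \<noteq> 0}"
      using u by (auto split: if_splits)
    then have "card {v \<in> V. c v \<noteq> 0} < card {v \<in> V. (c(u := k)) v \<noteq> 0}"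
      using V u by simp
    then have "\<not> P (c(u := k))" using c(2)[of "c(u := k)"] by auto
    moreover have "\<forall>v. (c(u := k)) v = 0 \<or> (c(u := k)) v = 1 \<or> (c(u := k)) v = -1"
      using c(1) \<open>k = 1 \<or> k = -1\<close> unfolding P_def fun_upd_apply by metis
    ultimately show "\<exists>x\<in>?J. ?pen (c(u := k)) x < m" unfolding P_def not_less[symmetric] by blast
  qed (use V E ends lh c(1) exchangeable_degree_vectors[OF E] in \<open>auto simp: P_def\<close>)
  have "?pen c x0 \<le> ?pen (\<lambda>_. 0) x0"
    unfolding total_penalty_def by (intro sum_mono) (auto simp: penalty_def)
  then have "x0 \<in> optimal" using x0 minimum[OF x0(1)] by (simp add: optimal_def)
  then have "optimal \<noteq> {}" by blast
  then obtain \<K> where \<K>: "pairwise disjnt \<K>" "\<forall>K\<in>\<K>. odd_block a b E l h R T K"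
    "(\<Sum>v\<in>S. h v) + (\<Sum>v\<in>T. edeg a b E v - l v) - ew all_edges S T = int (card \<K>) - m"
    by (rule odd_blocks_deficiency) blast
  have R: "R = V - S - T" using S_T_R by blast
  have "\<forall>K\<in>\<K>. odd_block a b E l h (V - S - T) T K"
    using \<K>(2) unfolding R .
  then show thesis
    using that[of S T \<K>] S_T_R(1) \<K>(1,3) \<open>0 < m\<close> by (auto simp: S_def T_def)
qed

section \<open>Rounding a fractional factor under parity constraints\<close>

text \<open>
  The graph with edges \<open>Inl e\<close> for \<open>e \<in> E\<close> and an additional loop \<open>Inr v\<close> at each \<open>v \<in> L\<close>.
\<close>

lemma edge_weight_loops:
  assumes "finite E" "finite L"
  shows "edge_weight (case_sum a (\<lambda>v. v)) (case_sum b (\<lambda>v. v)) (Inl ` E \<union> Inr ` L) w X Y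
    = edge_weight a b E (\<lambda>e. w (Inl e)) X Y + (\<Sum>v\<in>L. w (Inr v) * (2 * of_bool (v \<in> X \<and> v \<in> Y)))"
proof -
  have "Inl ` E \<inter> Inr ` L = {}" by auto
  then show ?thesis
    unfolding edge_weight_def using assms
    by (subst sum.union_disjoint) (auto simp: sum.reindex conj_commute mult.assoc)
qed

lemma disjoint_loops:
  fixes u :: "'v \<Rightarrow> 'r::comm_ring_1"
  assumes "X \<inter> Y = {}"
  shows "(\<Sum>v\<in>L. u v * (2 * of_bool (v \<in> X \<and> v \<in> Y))) = 0"
  using assms by (intro sum.neutral) auto

lemma edeg_loops:
  assumes "finite F" "finite M"
  shows "edeg (case_sum a (\<lambda>v. v)) (case_sum b (\<lambda>v. v)) (Inl ` F \<union> Inr ` M) v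
    = edeg a b F v + (if v \<in> M then 2 else 0)"
proof -
  have "Inl ` F \<inter> Inr ` M = {}" by auto
  moreover have "(\<Sum>u\<in>M. of_bool (u = v) + of_bool (u = v)) = (if v \<in> M then 2 else 0 :: int)"
    using assms(2) by (simp add: of_bool_def flip: mult_2 sum_distrib_left)
  ultimately show ?thesis
    unfolding edeg_def using assms by (simp add: sum.union_disjoint sum.reindex)
qed

lemma of_int_edge_weight: "of_int (edge_weight a b E w X Y) = edge_weight a b E (\<lambda>e. of_int (w e)) X Y"
  by (simp add: edge_weight_def)

lemma edge_weight_scale: "edge_weight a b E (\<lambda>e. k) X Y = k * edge_weight a b E (\<lambda>e. 1) X Y"
  by (simp add: edge_weight_def sum_distrib_left)

lemma sum_less_1:
  assumes "finite A" "\<And>v. v \<in> A \<Longrightarrow> v \<noteq> z \<Longrightarrow> t v \<le> (0::real)" "z \<in> A \<Longrightarrow> t z < 1"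
  shows "sum t A < 1"
proof (cases "z \<in> A")
  case True
  have "sum t (A - {z}) \<le> 0" using assms by (intro sum_nonpos) auto
  then show ?thesis using assms(1,3) True by (simp add: sum.remove)
next
  case False
  have "sum t A \<le> 0" using assms False by (intro sum_nonpos) auto
  then show ?thesis by simp
qed

lemma closed_set_reaches_itself:
  assumes "(u, v) \<in> (neighbours a b E V)\<^sup>*" "u \<in> K"
    "edge_weight a b E (\<lambda>_. 1::int) K (V - K) = 0" "finite E"
  shows "v \<in> K"
  using assms(1)
proof (induction rule: rtrancl_induct)
  case (step p q)
  have "\<And>e. e \<in> E \<Longrightarrow> \<not> (a e \<in> K \<and> b e \<in> V - K) \<and> \<not> (b e \<in> K \<and> a e \<in> V - K)"
    using assms(3,4) by (subst (asm) edge_weight_eq_0_iff) auto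
  then show ?case using step by (auto simp: neighbours_def)
qed (use assms in auto)

lemma neighbours_loops:
  assumes "(u, v) \<in> (neighbours (case_sum a (\<lambda>v. v)) (case_sum b (\<lambda>v. v)) (Inl ` E \<union> Inr ` L) X)\<^sup>*"
  shows "(u, v) \<in> (neighbours a b E X)\<^sup>*"
proof -
  have "neighbours (case_sum a (\<lambda>v. v)) (case_sum b (\<lambda>v. v)) (Inl ` E \<union> Inr ` L) X
      \<subseteq> (neighbours a b E X)\<^sup>="
    by (auto simp: neighbours_def)
  from rtrancl_mono[OF this] show ?thesis using assms unfolding rtrancl_reflcl by (rule subsetD)
qed

text \<open>
  The condition on cuts exempts the bipartite sets \<open>X\<close> with \<open>lo = hi\<close> on \<open>X\<close>: they receive no loop, so
  they stay bipartite and are not odd blocks. The degree of \<open>z\<close> may be prescribed off \<open>\<epsilon> d z\<close> by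
  less than 1, because the violated inequality of \<open>factor_theorem\<close> is one between integers.
\<close>

theorem parity_rounding:
  fixes a b :: "'e \<Rightarrow> 'v" and E :: "'e set" and lo hi :: "'v \<Rightarrow> int" and \<epsilon> :: real
  defines "d \<equiv> edeg a b E"
  assumes V: "finite V" and E: "finite E" and ends: "\<And>e. e \<in> E \<Longrightarrow> a e \<in> V \<and> b e \<in> V"
    and connected: "\<And>u v. u \<in> V \<Longrightarrow> v \<in> V \<Longrightarrow> (u, v) \<in> (neighbours a b E V)\<^sup>*"
    and V0: "V0 \<subseteq> V" and eps: "0 < \<epsilon>" "\<epsilon> < 1"
    and gap: "\<And>v. v \<in> V0 \<Longrightarrow> lo v = hi v \<or> lo v = hi v - 2"
    and interval: "\<And>v. v \<in> V - V0 \<Longrightarrow> lo v < hi v"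
    and approx: "\<And>v. v \<in> V \<Longrightarrow> v \<noteq> z \<or> v \<notin> V0 \<Longrightarrow> real_of_int (lo v) \<le> \<epsilon> * d v \<and> \<epsilon> * d v \<le> hi v"
    and approx_z: "z \<in> V0 \<Longrightarrow> real_of_int (lo z) \<le> \<epsilon> * d z \<and> \<epsilon> * d z \<le> hi z \<or>
        lo z = hi z \<and> \<bar>\<epsilon> * d z - hi z\<bar> < 1"
    and even_total: "V0 = V \<Longrightarrow> even (\<Sum>v\<in>V. hi v)"
    and cuts: "\<And>X. X \<noteq> {} \<Longrightarrow> X \<subset> V0 \<Longrightarrow>
        (\<And>u v. u \<in> X \<Longrightarrow> v \<in> X \<Longrightarrow> (u, v) \<in> (neighbours a b E X)\<^sup>*) \<Longrightarrow>
        \<not> ((\<exists>A B. A \<union> B = X \<and> A \<inter> B = {} \<and> edge_weight a b E (\<lambda>_. 1::int) A A = 0 \<and>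
                 edge_weight a b E (\<lambda>_. 1::int) B B = 0) \<and> (\<forall>v\<in>X. lo v = hi v)) \<Longrightarrow>
        (odd (\<Sum>v\<in>X. hi v) \<longrightarrow> 1 \<le> \<epsilon> * edge_weight a b E (\<lambda>_. 1::int) X (V - X)) \<and>
        (odd (\<Sum>v\<in>X. d v - hi v) \<longrightarrow> 1 \<le> (1 - \<epsilon>) * edge_weight a b E (\<lambda>_. 1::int) X (V - X))"
  shows "\<exists>F\<subseteq>E. \<forall>v\<in>V. lo v \<le> edeg a b F v \<and> edeg a b F v \<le> hi v \<and>
      (v \<in> V0 \<longrightarrow> even (edeg a b F v - hi v))"
proof (rule ccontr)
  assume none: "\<not> ?thesis"
  define L where "L = {v \<in> V0. lo v \<noteq> hi v}"
  \<comment> \<open>on \<open>V0\<close> the demand is exact, and the loop at \<open>v \<in> L\<close>, if chosen, makes up for the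
    difference between \<open>hi v - 2\<close> and \<open>hi v\<close>\<close>
  define l where "l v = (if v \<in> V - V0 then lo v else hi v)" for v
  define a' where "a' = case_sum a (\<lambda>v. v :: 'v)"
  define b' where "b' = case_sum b (\<lambda>v. v :: 'v)"
  define E' where "E' = Inl ` E \<union> Inr ` L"
  note prime_defs = a'_def b'_def E'_def
  have "L \<subseteq> V" using V0 by (auto simp: L_def)
  then have L: "L \<subseteq> V" "finite L" using V finite_subset by auto
  have fin': "finite E'" using E L by (auto simp: E'_def)
  have ends': "a' e \<in> V \<and> b' e \<in> V" if "e \<in> E'" for e
    using that ends L by (auto simp: prime_defs)
  have lh: "l v \<le> hi v" for v using interval[of v] by (auto simp: l_def)
  have no': "\<not> (\<exists>F\<subseteq>E'. \<forall>v\<in>V. l v \<le> edeg a' b' F v \<and> edeg a' b' F v \<le> hi v)"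
  proof
    assume "\<exists>F\<subseteq>E'. \<forall>v\<in>V. l v \<le> edeg a' b' F v \<and> edeg a' b' F v \<le> hi v"
    then obtain F' where F': "F' \<subseteq> E'" "\<And>v. v \<in> V \<Longrightarrow> l v \<le> edeg a' b' F' v \<and> edeg a' b' F' v \<le> hi v"
      by blast
    let ?F = "{e \<in> E. Inl e \<in> F'}" and ?M = "{v \<in> L. Inr v \<in> F'}"
    have "F' = Inl ` ?F \<union> Inr ` ?M" using F'(1) by (auto simp: E'_def)
    then have deg: "edeg a' b' F' v = edeg a b ?F v + (if v \<in> ?M then 2 else 0)" for v
      using edeg_loops[of ?F ?M a b v] E L unfolding a'_def b'_def by simp
    have "lo v \<le> edeg a b ?F v \<and> edeg a b ?F v \<le> hi v \<and> (v \<in> V0 \<longrightarrow> even (edeg a b ?F v - hi v))"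
      if v: "v \<in> V" for v
    proof (cases "v \<in> V0")
      case True
      then have "edeg a b ?F v = hi v - (if v \<in> ?M then 2 else 0)"
        using F'(2)[OF v] unfolding deg l_def by auto
      then show ?thesis using gap[OF True] by (auto simp: L_def)
    next
      case False
      then show ?thesis using F'(2)[OF v] v unfolding deg l_def L_def by auto
    qed
    moreover have "?F \<subseteq> E" by auto
    ultimately show False using none by blast
  qed
  obtain S T \<K> where ST: "S \<subseteq> V" "T \<subseteq> V" "S \<inter> T = {}" and disj: "pairwise disjnt \<K>"
    and odd_blocks: "\<forall>K\<in>\<K>. odd_block a' b' E' l hi (V - S - T) T K"
    and deficit: "(\<Sum>v\<in>S. hi v) + (\<Sum>v\<in>T. edeg a' b' E' v - l v)
      - edge_weight a' b' E' (\<lambda>_. 1) S T < int (card \<K>)"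
    by (rule factor_theorem[OF V fin' ends' lh no'])
  define R where "R = V - S - T"
  note finST = finite_subset[OF ST(1) V] finite_subset[OF ST(2) V]
  have VSTR: "V = S \<union> (T \<union> R)" "S \<inter> R = {}" "T \<inter> R = {}" using ST by (auto simp: R_def)
  \<comment> \<open>the loop weights make the weighted degree of each \<open>v \<in> L\<close> equal to \<open>hi v\<close>, as a loop counts twice\<close>
  define w :: "'e + 'v \<Rightarrow> real" where "w = case_sum (\<lambda>_. \<epsilon>) (\<lambda>v. (hi v - \<epsilon> * d v) / 2)"
  define ew :: "('e + 'v \<Rightarrow> real) \<Rightarrow> 'v set \<Rightarrow> 'v set \<Rightarrow> real" where "ew = edge_weight a' b' E'"
  have loop_weight: "0 \<le> w (Inr v) \<and> w (Inr v) \<le> 1" if "v \<in> L" for v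
  proof -
    have "v \<in> V0" "lo v = hi v - 2" using that gap by (auto simp: L_def)
    moreover from this have "real_of_int (lo v) \<le> \<epsilon> * d v \<and> \<epsilon> * d v \<le> hi v"
      using approx[of v] approx_z V0 by (cases "v = z") auto
    ultimately show ?thesis by (simp add: w_def)
  qed
  have w01: "0 \<le> w e" "w e \<le> 1" if "e \<in> E'" for e
    using that eps loop_weight by (auto simp: E'_def w_def)
  have ew_nonneg: "0 \<le> ew w X Y" "0 \<le> ew (\<lambda>e. 1 - w e) X Y" for X Y
    unfolding ew_def using w01 by (auto intro!: edge_weight_nonneg)
  have ew_1: "ew (\<lambda>_. 1) X Y = ew w X Y + ew (\<lambda>e. 1 - w e) X Y" for X Y
    unfolding ew_def edge_weight_add[symmetric] by simp
  define W where "W v = ew w {v} V" for v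
  have d_ew: "edge_weight a b E (\<lambda>_. 1) {v} V = d v" for v
    unfolding d_def using edeg_eq_edge_weight[OF E order.refl ends, where v = v] 
    by (auto intro: edge_weight_cong)
  have d_ew_real: "edge_weight a b E (\<lambda>_. 1) {v} V = real_of_int (d v)" for v
    using arg_cong[OF d_ew[of v], where f = real_of_int] by (simp add: of_int_edge_weight)
  have W: "W v = \<epsilon> * d v + (if v \<in> L then hi v - \<epsilon> * d v else 0)" for v
  proof -
    have "(\<Sum>u\<in>L. w (Inr u) * (2 * of_bool (u \<in> {v} \<and> u \<in> V))) = (\<Sum>u\<in>L. if u = v then 2 * w (Inr v) else 0)"
      using L by (intro sum.cong refl) auto
    also have "\<dots> = (if v \<in> L then hi v - \<epsilon> * d v else 0)" using L by (simp add: w_def)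
    finally show ?thesis
      unfolding W_def ew_def prime_defs edge_weight_loops[OF E L(2)]
      by (simp add: w_def edge_weight_scale[of a b E \<epsilon>] d_ew_real)
  qed
  have deg': "real_of_int (edeg a' b' E' v) = ew (\<lambda>_. 1) {v} V" for v
    using arg_cong[OF edeg_eq_edge_weight[OF fin' order.refl ends', where v = v], where f = real_of_int]
    unfolding ew_def of_int_edge_weight by (auto intro: edge_weight_cong)
  have split: "ew u X V = ew u X S + ew u X T + ew u X R" for u :: "_ \<Rightarrow> real" and X
    unfolding ew_def using VSTR ST(3)
    by (subst VSTR(1), subst edge_weight_Un_right; simp add: Int_Un_distrib edge_weight_Un_right)
  \<comment> \<open>by how much the bound at \<open>v\<close> lies on the wrong side of the weighted degree; positive at most for \<open>z\<close>\<close>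
  define t where "t v = (if v \<in> S then W v - hi v else l v - W v)" for v
  have t_le: "t v \<le> 0" if "v \<in> S \<union> T" "v \<noteq> z \<or> v \<notin> V0" for v
    using approx[of v] that ST interval[of v] unfolding t_def W l_def L_def by auto
  have t_z: "t z < 1" if "z \<in> V0" "z \<in> S \<union> T"
    using approx_z[OF that(1)] that unfolding t_def W l_def L_def by auto
  have err_lt: "sum t (S \<union> T) < 1"
    using t_le t_z finST by (intro sum_less_1[where z = z]) fastforce+
  have err_le: "sum t (S \<union> T) \<le> 0" if "(S \<union> T) \<inter> V0 = {}"
    using t_le that by (intro sum_nonpos) blast
  have err: "sum t (S \<union> T) = (\<Sum>v\<in>S. W v) - (\<Sum>v\<in>S. hi v) + ((\<Sum>v\<in>T. l v) - (\<Sum>v\<in>T. W v))"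
  proof -
    have "sum t T = (\<Sum>v\<in>T. l v - W v)" using ST(3) by (intro sum.cong refl) (auto simp: t_def)
    moreover have "sum t S = (\<Sum>v\<in>S. W v - hi v)" by (intro sum.cong refl) (auto simp: t_def)
    ultimately show ?thesis using finST ST(3) by (simp add: sum.union_disjoint sum_subtractf)
  qed
  have sumW: "(\<Sum>v\<in>X. W v) = ew w X V" if "finite X" for X
    unfolding W_def ew_def by (rule sum_edge_weight_singletons[OF that])
  have sum_deg': "real_of_int (\<Sum>v\<in>T. edeg a' b' E' v) = ew (\<lambda>_. 1) T V"
    unfolding of_int_sum deg' ew_def by (rule sum_edge_weight_singletons[OF finST(2)])
  define g where "g K = ew w S K + ew (\<lambda>e. 1 - w e) T K" for K
  have ob: "odd_block a' b' E' l hi R T K" if "K \<in> \<K>" for K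
    using odd_blocks that unfolding R_def by (rule bspec)
  have K: "K \<noteq> {}" "K \<subseteq> R" "K \<subseteq> V0" if "K \<in> \<K>" for K
  proof -
    show "K \<noteq> {}" "K \<subseteq> R" by (rule odd_blockD[OF ob[OF that]])+
    then have "K \<subseteq> V" by (auto simp: R_def)
    moreover have "l v \<noteq> hi v" if "v \<in> V - V0" for v
      using interval[OF that] that by (simp add: l_def)
    ultimately show "K \<subseteq> V0" using odd_blockD(3)[OF ob[OF that]] by blast
  qed
  have "\<K> \<subseteq> Pow V" using K(2) by (auto simp: R_def)
  then have fin\<K>: "finite \<K>" using V by (simp add: finite_subset)
  have R_le: "(\<Sum>K\<in>\<K>. ew u X K) \<le> ew u X R" if "\<And>e. e \<in> E' \<Longrightarrow> 0 \<le> u e" for u :: "_ \<Rightarrow> real" and X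
    unfolding ew_def edge_weight_Union_right[OF fin\<K> disj, symmetric]
    using that K(2) by (intro edge_weight_mono) auto
  \<comment> \<open>both sides of the deficiency inequality are integers, whence the 1\<close>
  have key: "1 - sum t (S \<union> T) + (\<Sum>K\<in>\<K>. g K) \<le> card \<K>"
  proof -
    have "(\<Sum>v\<in>S. hi v) + (\<Sum>v\<in>T. edeg a' b' E' v - l v) - edge_weight a' b' E' (\<lambda>_. 1) S T + 1 \<le> int (card \<K>)"
      using deficit by linarith
    then have "real_of_int ((\<Sum>v\<in>S. hi v) + (\<Sum>v\<in>T. edeg a' b' E' v - l v)
        - edge_weight a' b' E' (\<lambda>_. 1) S T + 1) \<le> real_of_int (int (card \<K>))"
      by (subst of_int_le_iff)
    then have "real_of_int (\<Sum>v\<in>S. hi v) + (ew (\<lambda>_. 1) T V - real_of_int (\<Sum>v\<in>T. l v)) - ew (\<lambda>_. 1) S T + 1 \<le> card \<K>"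
      unfolding sum_deg'[symmetric] by (simp add: sum_subtractf of_int_edge_weight ew_def)
    moreover have "sum t (S \<union> T) = ew w S V - real_of_int (\<Sum>v\<in>S. hi v) + (real_of_int (\<Sum>v\<in>T. l v) - ew w T V)"
      using err sumW finST by simp
    moreover have "(\<Sum>K\<in>\<K>. g K) \<le> ew w S R + ew (\<lambda>e. 1 - w e) T R"
      unfolding g_def sum.distrib using R_le[of w S] R_le[of "\<lambda>e. 1 - w e" T] w01 by (auto intro: add_mono)
    moreover have "ew u S T = ew u T S" for u :: "_ \<Rightarrow> real" unfolding ew_def by (rule edge_weight_commute)
    ultimately show ?thesis
      using split[of w S] split[of "\<lambda>e. 1 - w e" T] ew_1[of T V] ew_1[of S T] ew_nonneg[of S S]
        ew_nonneg[of T T] by (smt (verit))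
  qed
  define cnt where "cnt = edge_weight a b E (\<lambda>_. 1::int)"
  have cnt_nonneg: "0 \<le> cnt X Y" for X Y unfolding cnt_def by (intro edge_weight_nonneg) auto
  have cnt_le: "cnt X Y \<le> edge_weight a' b' E' (\<lambda>_. 1) X Y" for X Y
    unfolding cnt_def prime_defs edge_weight_loops[OF E L(2)] by (auto intro!: sum_nonneg)
  have g_eq: "g K = \<epsilon> * cnt K S + (1 - \<epsilon>) * cnt K T" if "K \<in> \<K>" for K
  proof -
    have KST: "S \<inter> K = {}" "T \<inter> K = {}" using K(2)[OF that] by (auto simp: R_def)
    have "g K = \<epsilon> * real_of_int (cnt S K) + (1 - \<epsilon>) * real_of_int (cnt T K)"
      unfolding g_def ew_def prime_defs edge_weight_loops[OF E L(2)]
        disjoint_loops[OF KST(1)] disjoint_loops[OF KST(2)] cnt_def of_int_edge_weight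
      by (simp add: w_def edge_weight_scale[of a b E \<epsilon>] edge_weight_scale[of a b E "1 - \<epsilon>"])
    then show ?thesis unfolding cnt_def by (simp add: edge_weight_commute)
  qed
  have boundary: "cnt K (V - K) = cnt K S + cnt K T" if "K \<in> \<K>" for K
  proof -
    have "edge_weight a' b' E' (\<lambda>_. 1::int) K (R - K) = 0"
      by (rule odd_blockD(5)[OF ob[OF that]])
    then have "cnt K (R - K) = 0" using cnt_le[of K "R - K"] cnt_nonneg[of K "R - K"] by simp
    moreover have "V - K = S \<union> (T \<union> (R - K))" using VSTR K(2)[OF that] by blast
    moreover have "S \<inter> (T \<union> (R - K)) = {}" "T \<inter> (R - K) = {}" using VSTR ST(3) by auto
    ultimately show ?thesis unfolding cnt_def by (simp add: edge_weight_Un_right)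
  qed
  have parity: "odd ((\<Sum>v\<in>K. hi v) + cnt K T)" if "K \<in> \<K>" for K
  proof -
    have "K \<inter> T = {}" using K(2)[OF that] by (auto simp: R_def)
    then have "edge_weight a' b' E' (\<lambda>_. 1::int) K T = cnt K T"
      unfolding prime_defs edge_weight_loops[OF E L(2)] cnt_def by (subst disjoint_loops) auto
    then show ?thesis using odd_blockD(6)[OF ob[OF that]] by simp
  qed
  have g_ge_1: "1 \<le> g K" if KK: "K \<in> \<K>" and proper: "K \<noteq> V0" for K
  proof -
    have sub: "K \<subset> V0" using K(3)[OF KK] proper by blast
    have conn: "(u, v) \<in> (neighbours a b E K)\<^sup>*" if "u \<in> K" "v \<in> K" for u v
      using odd_blockD(4)[OF ob[OF KK]] that neighbours_loops[of u v a b E L K]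
      unfolding prime_defs by blast
    have nonexc: "\<not> ((\<exists>A B. A \<union> B = K \<and> A \<inter> B = {} \<and> edge_weight a b E (\<lambda>_. 1::int) A A = 0 \<and>
        edge_weight a b E (\<lambda>_. 1::int) B B = 0) \<and> (\<forall>v\<in>K. lo v = hi v))"
    proof (intro notI; elim conjE exE)
      fix A B assume AB: "A \<union> B = K" "A \<inter> B = {}" "edge_weight a b E (\<lambda>_. 1::int) A A = 0"
        "edge_weight a b E (\<lambda>_. 1::int) B B = 0" and tight: "\<forall>v\<in>K. lo v = hi v"
      have "edge_weight a' b' E' (\<lambda>_. 1::int) X X = edge_weight a b E (\<lambda>_. 1) X X" if "X \<subseteq> K" for X
      proof -
        have "(\<Sum>v\<in>L. 1 * (2 * of_bool (v \<in> X \<and> v \<in> X))) = (0::int)"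
          using that tight by (intro sum.neutral) (auto simp: L_def)
        then show ?thesis unfolding prime_defs edge_weight_loops[OF E L(2)] by simp
      qed
      then have "edge_weight a' b' E' (\<lambda>_. 1::int) A A = 0" "edge_weight a' b' E' (\<lambda>_. 1::int) B B = 0"
        using AB by auto
      then show False using odd_blockD(7)[OF ob[OF KK]] AB(1,2) by blast
    qed
    note cut = cuts[OF K(1)[OF KK] sub conn nonexc, folded cnt_def, unfolded boundary[OF KK]]
    have KV: "K \<subseteq> V" using K(3)[OF KK] V0 by blast
    \<comment> \<open>each of the first two cases matches one of the two parity conditions on cuts\<close>
    consider "cnt K T = 0" | "cnt K S = 0" | "1 \<le> cnt K S" "1 \<le> cnt K T"
      using cnt_nonneg[of K S] cnt_nonneg[of K T] by linarith
    then show ?thesis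
    proof cases
      case 1
      then show ?thesis using cut parity[OF KK] unfolding g_eq[OF KK] by simp
    next
      case 2
      have "(\<Sum>v\<in>K. d v) = cnt K V"
        unfolding cnt_def d_ew[symmetric] using KV V finite_subset
        by (intro sum_edge_weight_singletons) blast
      also have "\<dots> = cnt K K + cnt K (V - K)"
        using edge_weight_Un_right[of K "V - K" a b E "\<lambda>_. 1::int" K] KV
        unfolding cnt_def by (simp add: Un_absorb1)
      finally have "(\<Sum>v\<in>K. d v - hi v) = cnt K K + cnt K T - (\<Sum>v\<in>K. hi v)"
        unfolding boundary[OF KK] using 2 by (simp add: sum_subtractf)
      moreover have "even (cnt K K)" unfolding cnt_def by (rule even_edge_weight_same)
      ultimately have "odd (\<Sum>v\<in>K. d v - hi v)" using parity[OF KK] by simp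
      then show ?thesis using cut 2 unfolding g_eq[OF KK] by simp
    next
      case 3
      then have "\<epsilon> * 1 + (1 - \<epsilon>) * 1 \<le> \<epsilon> * cnt K S + (1 - \<epsilon>) * cnt K T"
        using eps by (intro add_mono mult_left_mono) auto
      then show ?thesis unfolding g_eq[OF KK] by simp
    qed
  qed
  show False
  proof (cases "V0 \<in> \<K>")
    case False
    then have "(\<Sum>K\<in>\<K>. 1) \<le> (\<Sum>K\<in>\<K>. g K)" using g_ge_1 by (intro sum_mono) auto
    then show False using key err_lt by simp
  next
    case True
    \<comment> \<open>then \<open>V0\<close> is the only odd block and \<open>z\<close> is not in \<open>S \<union> T\<close>, so that there is no error at all\<close>
    have "K' = V0" if "K' \<in> \<K>" for K'
    proof (rule ccontr)
      assume "K' \<noteq> V0"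
      then have "K' \<inter> V0 = {}" using disj that True by (auto simp: pairwise_def disjnt_def)
      then show False using K(1,3)[OF that] by blast
    qed
    then have single: "\<K> = {V0}" using True by blast
    have "(S \<union> T) \<inter> V0 = {}" using K(2)[OF True] by (auto simp: R_def)
    then have "g V0 \<le> 0" using key err_le unfolding single by simp
    moreover have "0 \<le> \<epsilon> * cnt V0 S" "0 \<le> (1 - \<epsilon>) * cnt V0 T"
      using eps cnt_nonneg[of V0 S] cnt_nonneg[of V0 T] by auto
    ultimately have "\<epsilon> * cnt V0 S = 0" "(1 - \<epsilon>) * cnt V0 T = 0"
      unfolding g_eq[OF True] by linarith+
    then have zero: "cnt V0 S = 0" "cnt V0 T = 0" using eps by auto
    then have "cnt V0 (V - V0) = 0" using boundary[OF True] by simp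
    then have "V \<subseteq> V0"
      using connected closed_set_reaches_itself[of _ _ a b E V V0] K(1)[OF True] V0 E
      unfolding cnt_def by blast
    then have "V0 = V" using V0 by blast
    then show False using parity[OF True] even_total zero by simp
  qed
qed

section \<open>Factors of multigraphs\<close>

lemma of_int_bit_eq_1_iff: "(of_int n :: bit) = 1 \<longleftrightarrow> odd n"
proof (cases "even n")
  case True
  then obtain k where "n = k + k" by (metis evenE mult_2)
  then show ?thesis using True by (cases "of_int k :: bit") auto
next
  case False
  then obtain k where "n = k + k + 1" by (metis oddE mult_2)
  then show ?thesis using False by (cases "of_int k :: bit") auto
qed

lemma of_int_bit_eq_iff: "(of_int n :: bit) = p \<longleftrightarrow> (odd n \<longleftrightarrow> p = 1)"
  using of_int_bit_eq_1_iff[of n] by (cases p; cases "of_int n :: bit") auto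

text \<open>
  Together with \<open>parity_floor\<close> this gives the admissible degrees on \<open>V\<^sub>0\<close>. The two coincide if \<open>x\<close> is an integer
  of parity \<open>p\<close> and differ by 2 otherwise.
\<close>

definition parity_ceiling :: "bit \<Rightarrow> real \<Rightarrow> int" where
  "parity_ceiling p x = (if of_int \<lceil>x\<rceil> = p then \<lceil>x\<rceil> else \<lceil>x\<rceil> + 1)"

definition parity_floor :: "bit \<Rightarrow> real \<Rightarrow> int" where
  "parity_floor p x = (if of_int \<lfloor>x\<rfloor> = p then \<lfloor>x\<rfloor> else \<lfloor>x\<rfloor> - 1)"

lemma parity_floor_ceiling:
  fixes p :: bit and x :: real
  shows "of_int (parity_ceiling p x) = p" "of_int (parity_floor p x) = p"
    "parity_floor p x = parity_ceiling p x \<or> parity_floor p x = parity_ceiling p x - 2"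
    "of_int (parity_floor p x) \<le> x" "x \<le> of_int (parity_ceiling p x)"
    "\<lfloor>x\<rfloor> - 1 \<le> parity_floor p x" "parity_ceiling p x \<le> \<lceil>x\<rceil> + 1"
    "x = of_int k \<Longrightarrow> of_int k = p \<Longrightarrow> parity_floor p x = parity_ceiling p x"
    "parity_floor p x < \<lceil>x\<rceil> - 1 \<Longrightarrow> \<bar>x - parity_ceiling p x\<bar> < 1"
    "\<lfloor>x\<rfloor> + 1 < parity_ceiling p x \<Longrightarrow> \<bar>x - parity_floor p x\<bar> < 1"
proof -
  note defs = parity_ceiling_def parity_floor_def of_int_bit_eq_iff
  have fc: "\<lceil>x\<rceil> = \<lfloor>x\<rfloor> \<and> x = of_int \<lfloor>x\<rfloor> \<or> \<lceil>x\<rceil> = \<lfloor>x\<rfloor> + 1"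
    by (metis ceiling_altdef)
  have fl: "of_int \<lfloor>x\<rfloor> \<le> x" "x < of_int \<lfloor>x\<rfloor> + 1" by linarith+
  have ce: "x \<le> of_int \<lceil>x\<rceil>" by (rule le_of_int_ceiling)
  show "of_int (parity_ceiling p x) = p" "of_int (parity_floor p x) = p"
    by (auto simp: defs)
  show "parity_floor p x = parity_ceiling p x \<or> parity_floor p x = parity_ceiling p x - 2"
    using fc by (auto simp: defs)
  show "of_int (parity_floor p x) \<le> x" "x \<le> of_int (parity_ceiling p x)"
    unfolding parity_floor_def parity_ceiling_def using fl ce by (simp_all split: if_split) linarith+
  show "\<lfloor>x\<rfloor> - 1 \<le> parity_floor p x" "parity_ceiling p x \<le> \<lceil>x\<rceil> + 1"
    by (simp_all add: parity_ceiling_def parity_floor_def)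
  show "x = of_int k \<Longrightarrow> of_int k = p \<Longrightarrow> parity_floor p x = parity_ceiling p x"
    by (simp add: parity_ceiling_def parity_floor_def)
  show "\<bar>x - parity_ceiling p x\<bar> < 1" if *: "parity_floor p x < \<lceil>x\<rceil> - 1"
  proof -
    have "\<lceil>x\<rceil> = \<lfloor>x\<rfloor> + 1 \<and> parity_ceiling p x = \<lfloor>x\<rfloor> + 1" if "\<lceil>x\<rceil> = \<lfloor>x\<rfloor> + 1"
      using * that by (auto simp: defs split: if_splits)
    moreover have "\<lceil>x\<rceil> \<noteq> \<lfloor>x\<rfloor>" using * by (auto simp: defs split: if_splits)
    moreover have "of_int \<lfloor>x\<rfloor> < x"
      using fl(1) \<open>\<lceil>x\<rceil> \<noteq> \<lfloor>x\<rfloor>\<close> by (metis ceiling_of_int order_le_less)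
    ultimately show ?thesis using fc fl by auto
  qed
  show "\<bar>x - parity_floor p x\<bar> < 1" if *: "\<lfloor>x\<rfloor> + 1 < parity_ceiling p x"
  proof -
    have "parity_floor p x = \<lfloor>x\<rfloor>"
      using * fc by (auto simp: defs split: if_splits)
    then show ?thesis using fl by linarith
  qed
qed

lemma card_filter_eq_sum: "finite A \<Longrightarrow> int (card {e \<in> A. P e}) = (\<Sum>e\<in>A. of_bool (P e))"
  by (simp add: sum_of_bool_eq Int_def)

locale oriented_mgraph = finite_mgraph G for G :: "('v, 'e) mgraph" +
  fixes a b :: "'e \<Rightarrow> 'v"
  assumes ends_eq: "ends G e = Upair (a e) (b e)"
begin

lemma ends_in: "e \<in> edges G \<Longrightarrow> a e \<in> verts G \<and> b e \<in> verts G"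
  using ends_in_verts[of e] by (simp add: ends_eq)

abbreviation "between \<equiv> edge_weight a b (edges G) (\<lambda>_. 1::int)"

lemma degree_eq_edeg:
  assumes "is_factor F G"
  shows "int (degree F v) = edeg a b (edges F) v"
proof -
  have fin: "finite (edges F)" using assms finite_edges by (auto simp: is_factor_def finite_subset)
  have "int (degree F v) = (\<Sum>e\<in>edges F. of_bool (v \<in> set_uprod (ends F e)) + of_bool (ends F e = Upair v v))"
    unfolding degree_def sum.distrib using fin by (simp add: card_filter_eq_sum)
  also have "\<dots> = edeg a b (edges F) v"
    unfolding edeg_def using assms
    by (intro sum.cong refl) (auto simp: is_factor_def ends_eq)
  finally show ?thesis .
qed

lemma degree_G: "int (degree G v) = edeg a b (edges G) v"
  by (rule degree_eq_edeg) (simp add: is_factor_def)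

lemma cut_degree_eq:
  "int (cut_degree G X) = between X (verts G - X)"
proof -
  have "int (cut_degree G X) = (\<Sum>e\<in>edges G. of_bool (\<exists>u v. ends G e = Upair u v \<and> u \<in> X \<and> v \<notin> X))"
    unfolding cut_degree_def using finite_edges by (simp add: card_filter_eq_sum)
  also have "\<dots> = between X (verts G - X)"
    unfolding edge_weight_def using ends_in
    by (intro sum.cong refl) (auto simp: ends_eq of_bool_def)
  finally show ?thesis .
qed

lemma adjacency_neighbours: "adjacency G \<subseteq> neighbours a b (edges G) (verts G)"
  using ends_in by (auto simp: adjacency_def neighbours_def ends_eq)

lemma connected_induced:
  assumes "X \<noteq> {}" "X \<subseteq> verts G"
    and "\<And>u v. u \<in> X \<Longrightarrow> v \<in> X \<Longrightarrow> (u, v) \<in> (neighbours a b (edges G) X)\<^sup>*"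
  shows "graph_connected (induced_subgraph G X)"
proof -
  have "neighbours a b (edges G) X \<subseteq> adjacency (induced_subgraph G X)"
    by (fastforce simp: neighbours_def adjacency_def induced_subgraph_def ends_eq)
  then have "(u, v) \<in> (adjacency (induced_subgraph G X))\<^sup>*" if "u \<in> X" "v \<in> X" for u v
    using assms(3)[OF that] by (rule subsetD[OF rtrancl_mono])
  moreover have "verts (induced_subgraph G X) = X"
    using assms(2) by (auto simp: induced_subgraph_def)
  ultimately show ?thesis using assms(1) by (simp add: graph_connected_def)
qed

lemma bipartite_induced:
  assumes "bipartite (induced_subgraph G X)" "X \<subseteq> verts G"
  shows "\<exists>A B. A \<union> B = X \<and> A \<inter> B = {} \<and> between A A = 0 \<and> between B B = 0"
proof -
  obtain A B where AB: "A \<union> B = X" "A \<inter> B = {}"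
    and e: "\<And>e. e \<in> edges G \<Longrightarrow> a e \<in> X \<Longrightarrow> b e \<in> X \<Longrightarrow> \<exists>u\<in>A. \<exists>v\<in>B. ends G e = Upair u v"
  proof -
    obtain A B where AB: "A \<union> B = verts (induced_subgraph G X)" "A \<inter> B = {}"
      and e: "\<forall>e\<in>edges (induced_subgraph G X). \<exists>u\<in>A. \<exists>v\<in>B. ends (induced_subgraph G X) e = Upair u v"
      using assms(1) unfolding bipartite_def by blast
    show thesis
    proof (rule that)
      show "A \<union> B = X" using AB(1) assms(2) by (auto simp: induced_subgraph_def)
      show "\<exists>u\<in>A. \<exists>v\<in>B. ends G e = Upair u v" if "e \<in> edges G" "a e \<in> X" "b e \<in> X" for e
        using e that by (simp add: induced_subgraph_def ends_eq)
    qed (rule AB(2))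
  qed
  have "\<not> (a e \<in> A \<and> b e \<in> A)" "\<not> (a e \<in> B \<and> b e \<in> B)" if "e \<in> edges G" for e
    using e[OF that] AB by (auto simp: ends_eq)
  then have "between A A = 0" "between B B = 0"
    using finite_edges by (subst edge_weight_eq_0_iff; auto)+
  then show ?thesis using AB by blast
qed

text \<open>
  The three variants of the main theorem differ only in the admissible degrees at \<open>z\<close>. The vertices
  outside \<open>V0 \<union> V1 \<union> V1'\<close> are treated like those in \<open>V1\<close>.
\<close>

lemma good_factor_within_bounds:
  fixes f :: "'v \<Rightarrow> bit" and \<epsilon> :: real and lo hi :: "'v \<Rightarrow> int"
  defines "x \<equiv> \<lambda>v. \<epsilon> * real (degree G v)"
  assumes conn: "graph_connected G"
    and sub: "V0 \<subseteq> verts G" "V1 \<subseteq> verts G" "V1' \<subseteq> verts G"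
    and disj: "V0 \<inter> V1 = {}" "V0 \<inter> V1' = {}" "V1 \<inter> V1' = {}"
    and eps: "0 < \<epsilon>" "\<epsilon> < 1"
    and total: "(\<Sum>v\<in>V0. f v) = 0 \<or> V0 \<noteq> verts G"
    and cuts: "\<And>X. X \<noteq> {} \<Longrightarrow> X \<subset> V0 \<Longrightarrow> \<not> exceptional G f \<epsilon> X \<Longrightarrow>
           ((\<Sum>v\<in>X. f v) = 1 \<longrightarrow> real (cut_degree G X) \<ge> 1 / \<epsilon>) \<and>
           ((\<Sum>v\<in>X. of_nat (degree G v) - f v) = 1 \<longrightarrow> real (cut_degree G X) \<ge> 1 / (1 - \<epsilon>))"
    and gap: "\<And>v. v \<in> V0 \<Longrightarrow> lo v = hi v \<or> lo v = hi v - 2"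
    and parity: "\<And>v. v \<in> V0 \<Longrightarrow> of_int (hi v) = f v"
    and range: "\<And>v. v \<in> V0 \<Longrightarrow> \<lfloor>x v\<rfloor> - 1 \<le> lo v \<and> hi v \<le> \<lceil>x v\<rceil> + 1"
    and tight: "\<And>v k. v \<in> V0 \<Longrightarrow> x v = of_int k \<Longrightarrow> of_int k = f v \<Longrightarrow> lo v = hi v"
    and approx: "\<And>v. v \<in> V0 \<Longrightarrow> v \<noteq> z \<Longrightarrow> of_int (lo v) \<le> x v \<and> x v \<le> of_int (hi v)"
    and approx_z: "z \<in> V0 \<Longrightarrow> of_int (lo z) \<le> x z \<and> x z \<le> of_int (hi z) \<or>
        lo z = hi z \<and> \<bar>x z - hi z\<bar> < 1"
  shows "\<exists>F. good_factor G V0 V1 V1' f \<epsilon> F \<and>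
      (\<forall>v\<in>V0. lo v \<le> int (degree F v) \<and> int (degree F v) \<le> hi v)"
proof -
  let ?V = "verts G" and ?E = "edges G" and ?d = "edeg a b (edges G)"
  define l where "l v = (if v \<in> V0 then lo v else if v \<in> V1' then \<lfloor>x v\<rfloor> else \<lceil>x v\<rceil> - 1)" for v
  define h where "h v = (if v \<in> V0 then hi v else if v \<in> V1' then \<lfloor>x v\<rfloor> + 1 else \<lceil>x v\<rceil>)" for v
  have x: "x v = \<epsilon> * real_of_int (?d v)" for v
    unfolding x_def degree_G[symmetric] by simp
  have h_f: "of_int (\<Sum>v\<in>X. h v) = (\<Sum>v\<in>X. f v)" if "X \<subseteq> V0" for X
    unfolding of_int_sum using that parity by (intro sum.cong) (auto simp: h_def)
  have d_f: "of_int (\<Sum>v\<in>X. ?d v - h v) = (\<Sum>v\<in>X. of_nat (degree G v) - f v)" if "X \<subseteq> V0" for X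
    unfolding of_int_sum
  proof (intro sum.cong refl)
    fix v assume "v \<in> X"
    then have "of_int (h v) = f v" using that parity by (auto simp: h_def)
    then show "of_int (?d v - h v) = of_nat (degree G v) - f v"
      unfolding degree_G[symmetric] by simp
  qed
  have "\<exists>F\<subseteq>?E. \<forall>v\<in>?V. l v \<le> edeg a b F v \<and> edeg a b F v \<le> h v \<and>
      (v \<in> V0 \<longrightarrow> even (edeg a b F v - h v))"
  proof (rule parity_rounding[where \<epsilon> = \<epsilon> and z = z])
    fix u v assume "u \<in> ?V" "v \<in> ?V"
    then have "(u, v) \<in> (adjacency G)\<^sup>*" using conn by (simp add: graph_connected_def)
    then show "(u, v) \<in> (neighbours a b ?E ?V)\<^sup>*" using rtrancl_mono[OF adjacency_neighbours] by blast
  next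
    fix v assume "v \<in> V0"
    then show "l v = h v \<or> l v = h v - 2" using gap by (simp add: l_def h_def)
  next
    fix v assume "v \<in> ?V - V0"
    then show "l v < h v" by (simp add: l_def h_def)
  next
    fix v assume "v \<noteq> z \<or> v \<notin> V0"
    then have "of_int (l v) \<le> x v \<and> x v \<le> of_int (h v)"
      using approx[of v] unfolding l_def h_def by (auto simp: ceiling_correct)
    then show "of_int (l v) \<le> \<epsilon> * ?d v \<and> \<epsilon> * ?d v \<le> of_int (h v)" unfolding x .
  next
    assume "z \<in> V0"
    then show "of_int (l z) \<le> \<epsilon> * ?d z \<and> \<epsilon> * ?d z \<le> of_int (h z) \<or>
        l z = h z \<and> \<bar>\<epsilon> * ?d z - of_int (h z)\<bar> < 1"
      using approx_z unfolding x l_def h_def by simp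
  next
    assume "V0 = ?V"
    then have "(of_int (\<Sum>v\<in>?V. h v) :: bit) \<noteq> 1" using total h_f[of V0] by simp
    then show "even (\<Sum>v\<in>?V. h v)" unfolding of_int_bit_eq_1_iff by simp
  next
    fix X assume X: "X \<noteq> {}" "X \<subset> V0"
      and Xconn: "\<And>u v. u \<in> X \<Longrightarrow> v \<in> X \<Longrightarrow> (u, v) \<in> (neighbours a b ?E X)\<^sup>*"
      and nonbip: "\<not> ((\<exists>A B. A \<union> B = X \<and> A \<inter> B = {} \<and> between A A = 0 \<and> between B B = 0) \<and>
        (\<forall>v\<in>X. l v = h v))"
    have XV: "X \<subseteq> ?V" "X \<subseteq> V0" using X sub by auto
    have "\<not> exceptional G f \<epsilon> X"
    proof
      assume "exceptional G f \<epsilon> X"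
      moreover have "graph_connected (induced_subgraph G X)"
        by (rule connected_induced[OF X(1) XV(1) Xconn])
      ultimately have bip: "bipartite (induced_subgraph G X)"
        and int: "\<forall>v\<in>X. \<exists>k::int. \<epsilon> * real (degree G v) = of_int k \<and> of_int k = f v"
        by (simp_all add: exceptional_def)
      have "l v = h v" if v: "v \<in> X" for v
      proof -
        have "v \<in> V0" using v XV(2) by blast
        moreover obtain k :: int where "x v = of_int k" "of_int k = f v"
          using bspec[OF int v] by (auto simp: x_def)
        ultimately show ?thesis using tight[of v k] by (simp add: l_def h_def)
      qed
      then show False using nonbip bipartite_induced[OF bip XV(1)] by blast
    qed
    note cut = cuts[OF X this]
    have deg: "real (cut_degree G X) = real_of_int (between X (?V - X))"
      unfolding cut_degree_eq[symmetric] by simp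
    show "(odd (\<Sum>v\<in>X. h v) \<longrightarrow> 1 \<le> \<epsilon> * between X (?V - X)) \<and>
        (odd (\<Sum>v\<in>X. ?d v - h v) \<longrightarrow> 1 \<le> (1 - \<epsilon>) * between X (?V - X))"
      using cut eps unfolding of_int_bit_eq_1_iff[symmetric] h_f[OF XV(2)] d_f[OF XV(2)] deg
      by (simp add: pos_divide_le_eq mult.commute)
  qed (use finite_verts finite_edges ends_in sub eps in auto)
  then obtain H where H: "H \<subseteq> ?E" and bounds: "\<And>v. v \<in> ?V \<Longrightarrow> l v \<le> edeg a b H v \<and>
      edeg a b H v \<le> h v \<and> (v \<in> V0 \<longrightarrow> even (edeg a b H v - h v))" by blast
  define F where "F = \<lparr>verts = ?V, edges = H, ends = ends G\<rparr>"
  have factor: "is_factor F G" using H by (simp add: is_factor_def F_def)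
  have deg: "int (degree F v) = edeg a b H v" for v
    using degree_eq_edeg[OF factor] by (simp add: F_def)
  have V0: "lo v \<le> int (degree F v) \<and> int (degree F v) \<le> hi v \<and> of_nat (degree F v) = f v" if "v \<in> V0" for v
  proof -
    have "even (int (degree F v) - hi v)" "lo v \<le> int (degree F v)" "int (degree F v) \<le> hi v"
      using bounds[of v] that sub deg by (auto simp: l_def h_def)
    moreover from this(1) have "of_int (int (degree F v)) = f v"
      using parity[OF that] unfolding of_int_bit_eq_iff by simp
    ultimately show ?thesis by simp
  qed
  have "good_factor G V0 V1 V1' f \<epsilon> F"
    unfolding good_factor_def x_def[symmetric]
  proof (intro conjI ballI factor)
    fix v assume v: "v \<in> V0"
    show "\<lfloor>\<epsilon> * real (degree G v)\<rfloor> - 1 \<le> int (degree F v)" "int (degree F v) \<le> \<lceil>\<epsilon> * real (degree G v)\<rceil> + 1"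
      "of_nat (degree F v) = f v" using V0[OF v] range[OF v] unfolding x_def by auto
  next
    fix v assume v: "v \<in> V1"
    then have "v \<notin> V0" "v \<notin> V1'" "v \<in> ?V" using sub disj by auto
    then show "\<lceil>\<epsilon> * real (degree G v)\<rceil> - 1 \<le> int (degree F v)" "int (degree F v) \<le> \<lceil>\<epsilon> * real (degree G v)\<rceil>"
      using bounds[of v] unfolding deg l_def h_def x_def by auto
  next
    fix v assume v: "v \<in> V1'"
    then have "v \<notin> V0" "v \<in> ?V" using sub disj by auto
    then show "\<lfloor>\<epsilon> * real (degree G v)\<rfloor> \<le> int (degree F v)" "int (degree F v) \<le> \<lfloor>\<epsilon> * real (degree G v)\<rfloor> + 1"
      using bounds[of v] v unfolding deg l_def h_def x_def by auto
  qed
  then show ?thesis using V0 by blast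
qed

end

theorem theorem7p2:
  fixes G :: "('v, 'e) mgraph"
    and V\<^sub>0 V\<^sub>1 V\<^sub>1' :: "'v set"
    and f :: "'v \<Rightarrow> bit"
    and \<epsilon> :: real
  assumes "finite_mgraph G"
    and "graph_connected G"
    and "V\<^sub>0 \<subseteq> verts G" and "V\<^sub>1 \<subseteq> verts G" and "V\<^sub>1' \<subseteq> verts G"
    and "V\<^sub>0 \<inter> V\<^sub>1 = {}" and "V\<^sub>0 \<inter> V\<^sub>1' = {}" and "V\<^sub>1 \<inter> V\<^sub>1' = {}"
    and "0 < \<epsilon>" and "\<epsilon> < 1"
    and "(\<Sum>v\<in>V\<^sub>0. f v) = 0 \<or> V\<^sub>0 \<noteq> verts G"
    and "\<And>X. X \<noteq> {} \<Longrightarrow> X \<subset> V\<^sub>0 \<Longrightarrow> \<not> exceptional G f \<epsilon> X \<Longrightarrow>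
           ((\<Sum>v\<in>X. f v) = 1 \<longrightarrow> real (cut_degree G X) \<ge> 1 / \<epsilon>) \<and>
           ((\<Sum>v\<in>X. of_nat (degree G v) - f v) = 1 \<longrightarrow> real (cut_degree G X) \<ge> 1 / (1 - \<epsilon>))"
  shows "(\<exists>F. good_factor G V\<^sub>0 V\<^sub>1 V\<^sub>1' f \<epsilon> F) \<and>
         (\<forall>z \<in> V\<^sub>0.
            (\<exists>F. good_factor G V\<^sub>0 V\<^sub>1 V\<^sub>1' f \<epsilon> F \<and>
                 int (degree F z) \<ge> \<lceil>\<epsilon> * real (degree G z)\<rceil> - 1) \<and>
            (\<exists>F. good_factor G V\<^sub>0 V\<^sub>1 V\<^sub>1' f \<epsilon> F \<and>
                 int (degree F z) \<le> \<lfloor>\<epsilon> * real (degree G z)\<rfloor> + 1))"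
proof -
  have "\<exists>u v. ends G e = Upair u v" for e by (cases "ends G e") auto
  then obtain a b where ab: "\<And>e. ends G e = Upair (a e) (b e)" by metis
  interpret oriented_mgraph G a b
    using assms(1) ab by (simp add: oriented_mgraph_def oriented_mgraph_axioms_def)
  define x where "x v = \<epsilon> * real (degree G v)" for v
  define lo where "lo v = parity_floor (f v) (x v)" for v
  define hi where "hi v = parity_ceiling (f v) (x v)" for v
  note rounding = parity_floor_ceiling[where p = "f v" and x = "x v" for v, folded lo_def hi_def]
  note within = good_factor_within_bounds[OF assms(2-12), folded x_def]
  have base: "\<exists>F. good_factor G V\<^sub>0 V\<^sub>1 V\<^sub>1' f \<epsilon> F"
    using within[of lo hi undefined] rounding by blast
  have lower: "\<exists>F. good_factor G V\<^sub>0 V\<^sub>1 V\<^sub>1' f \<epsilon> F \<and> \<lceil>x z\<rceil> - 1 \<le> int (degree F z)" if z: "z \<in> V\<^sub>0" for z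
  proof -
    \<comment> \<open>at \<open>z\<close> the smaller admissible degree is dropped if it violates the desired bound\<close>
    define lo' where "lo' = lo(z := if lo z < \<lceil>x z\<rceil> - 1 then hi z else lo z)"
    have "\<exists>F. good_factor G V\<^sub>0 V\<^sub>1 V\<^sub>1' f \<epsilon> F \<and>
        (\<forall>v\<in>V\<^sub>0. lo' v \<le> int (degree F v) \<and> int (degree F v) \<le> hi v)"
    proof (rule within[where z = z])
      fix v
      show "lo' v = hi v \<or> lo' v = hi v - 2" "of_int (hi v) = f v"
        using rounding by (auto simp: lo'_def)
      show "\<lfloor>x v\<rfloor> - 1 \<le> lo' v \<and> hi v \<le> \<lceil>x v\<rceil> + 1"
        using rounding(3,6,7)[of v] by (auto simp: lo'_def)
      show "x v = of_int k \<Longrightarrow> of_int k = f v \<Longrightarrow> lo' v = hi v" for k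
        using rounding(8) by (auto simp: lo'_def)
      show "v \<noteq> z \<Longrightarrow> of_int (lo' v) \<le> x v \<and> x v \<le> of_int (hi v)"
        using rounding(4,5)[of v] by (simp add: lo'_def)
      show "of_int (lo' z) \<le> x z \<and> x z \<le> of_int (hi z) \<or> lo' z = hi z \<and> \<bar>x z - hi z\<bar> < 1"
        using rounding(4,5,9)[of z] by (simp add: lo'_def)
    qed
    moreover have "\<lceil>x z\<rceil> - 1 \<le> lo' z"
      using rounding(5)[of z] ceiling_le[of "x z" "hi z"] by (simp add: lo'_def)
    ultimately show ?thesis using z by (meson order_trans)
  qed
  have upper: "\<exists>F. good_factor G V\<^sub>0 V\<^sub>1 V\<^sub>1' f \<epsilon> F \<and> int (degree F z) \<le> \<lfloor>x z\<rfloor> + 1" if z: "z \<in> V\<^sub>0" for z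
  proof -
    \<comment> \<open>at \<open>z\<close> the larger admissible degree is dropped if it violates the desired bound\<close>
    define hi' where "hi' = hi(z := if \<lfloor>x z\<rfloor> + 1 < hi z then lo z else hi z)"
    have "\<exists>F. good_factor G V\<^sub>0 V\<^sub>1 V\<^sub>1' f \<epsilon> F \<and>
        (\<forall>v\<in>V\<^sub>0. lo v \<le> int (degree F v) \<and> int (degree F v) \<le> hi' v)"
    proof (rule within[where z = z])
      fix v
      show "lo v = hi' v \<or> lo v = hi' v - 2" "of_int (hi' v) = f v"
        using rounding by (auto simp: hi'_def)
      show "\<lfloor>x v\<rfloor> - 1 \<le> lo v \<and> hi' v \<le> \<lceil>x v\<rceil> + 1"
        using rounding(3,6,7)[of v] by (auto simp: hi'_def)
      show "x v = of_int k \<Longrightarrow> of_int k = f v \<Longrightarrow> lo v = hi' v" for k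
        using rounding(8) by (auto simp: hi'_def)
      show "v \<noteq> z \<Longrightarrow> of_int (lo v) \<le> x v \<and> x v \<le> of_int (hi' v)"
        using rounding(4,5)[of v] by (simp add: hi'_def)
      show "of_int (lo z) \<le> x z \<and> x z \<le> of_int (hi' z) \<or> lo z = hi' z \<and> \<bar>x z - hi' z\<bar> < 1"
        using rounding(4,5,10)[of z] by (simp add: hi'_def)
    qed
    moreover have "hi' z \<le> \<lfloor>x z\<rfloor> + 1"
      using rounding(4)[of z] le_floor_iff[of "lo z" "x z"] by (simp add: hi'_def)
    ultimately show ?thesis using z by (meson order_trans)
  qed
  show ?thesis using base lower upper unfolding x_def by blast
qed

end
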